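(* Let $u:[0,1]\to\mathbb{R}$ be piecewise continuous, and suppose the prior is uniform over $[0,1]$ and the payoff $u$ is antisymmetric and single-crossing, i.e. $u(t)=-u(1-t)$ for all $t\in[0,1]$ and $u(t)<0$ for $t\in[0,1/2)$. Then the optimal solution of Problem $(P)$ is interior, i.e. it takes values strictly between $0$ and $1$ at every $t\in[0,1]$. Let $p_*$ be the interior optimal solution of Problem $(P)$. Then $$p_*''(t)>0 \text{ on } [0,1/2),\quad\text{and}\quad p_*''(t)<0 \text{ on } (1/2,1].$$
   Context: Piecewise continuous: $u:[0,1]\to\mathbb{R}$ is piecewise continuous if there are $0=t_0<t_1<\dots<t_N=1$ such that $u$ is continuous on each $(t_i,t_{i+1})$, $i=0,\dots,N-1$, the left limits of $u$ exist and are finite at $t_1,\dots,t_N$, and the right limits exist and are finite at $t_0,\dots,t_{N-1}$. Problem $(P)$ (state space $[0,1]$, uniform prior, cost scale $1$): minimize over absolutely continuous $p:[0,1]\to[0,1]$ the functional $$J^P[p]=\int_0^1 \left(\frac{(p'(t))^2}{p(t)(1-p(t))}-u(t)p(t)\right)dt,$$ where the quotient is taken to be $0$ if $p(t)\in\{0,1\}$ and $p'(t)=0$, and $+\infty$ if $p(t)\in\{0,1\}$ and $p'(t)\neq0$. An optimal solution is a $p_*$ attaining the minimum with finite value.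
   Formalization: Where u is discontinuous p'' may not exist, so there the sign is claimed for the left and right second derivatives; at t=0 (resp. t=1) the strict sign is not claimed if u is discontinuous there with one-sided limit 0, since p'' then vanishes. *)

theory Defs
  imports "HOL-Analysis.Analysis"
begin

text \<open>Functions on $[0,1]$ are represented by functions of type \<^typ>\<open>real \<Rightarrow> real\<close>; their
  values outside do not matter.\<close>

definition piecewise_continuous :: "(real \<Rightarrow> real) \<Rightarrow> bool" where
  "piecewise_continuous u \<longleftrightarrow>
    (\<exists>(N::nat) \<tau>. \<tau> 0 = 0 \<and> \<tau> N = 1 \<and>
      (\<forall>i<N. \<tau> i < \<tau> (Suc i) \<and>
        continuous_on {\<tau> i<..<\<tau> (Suc i)} u \<and>
        (\<exists>r. (u \<longlongrightarrow> r) (at_right (\<tau> i))) \<and>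
        (\<exists>l. (u \<longlongrightarrow> l) (at_left (\<tau> (Suc i))))))"

text \<open>The \<open>\<epsilon>\<close>-\<open>\<delta>\<close> definition of absolute continuity; the pair \<open>(x, y)\<close> stands for the interval
  with end points \<open>x \<le> y\<close>.\<close>

definition abs_cont_on :: "real \<Rightarrow> real \<Rightarrow> (real \<Rightarrow> real) \<Rightarrow> bool" where
  "abs_cont_on a b p \<longleftrightarrow>
    (\<forall>\<epsilon>>0. \<exists>\<delta>>0. \<forall>I::(real \<times> real) set.
      finite I \<and> (\<forall>(x, y)\<in>I. a \<le> x \<and> x \<le> y \<and> y \<le> b) \<and>
      disjoint_family_on (\<lambda>(x, y). {x<..<y}) I \<and>
      (\<Sum>(x, y)\<in>I. y - x) < \<delta> \<longrightarrow>
      (\<Sum>(x, y)\<in>I. \<bar>p y - p x\<bar>) < \<epsilon>)"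

definition admissible :: "(real \<Rightarrow> real) \<Rightarrow> bool" where
  "admissible p \<longleftrightarrow> abs_cont_on 0 1 p \<and> (\<forall>t\<in>{0..1}. p t \<in> {0..1})"

definition info_cost :: "(real \<Rightarrow> real) \<Rightarrow> real \<Rightarrow> ereal" where
  "info_cost p t =
    (if p t \<in> {0, 1} then (if deriv p t = 0 then 0 else \<infinity>)
     else ereal ((deriv p t)\<^sup>2 / (p t * (1 - p t))))"

text \<open>Lebesgue integral of an extended real function, as integral of the positive part minus
  integral of the negative part (\<^const>\<open>e2ennreal\<close> truncates at \<open>0\<close>). Its only use is for integrands
  that are bounded below on $[0,1]$, where \<open>\<infinity> - \<infinity>\<close> does not arise. An absolutely continuous
  function is differentiable only almost everywhere, so the arbitrary value of \<^const>\<open>deriv\<close> at the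
  remaining points does not matter.\<close>

definition ereal_integral :: "real set \<Rightarrow> (real \<Rightarrow> ereal) \<Rightarrow> ereal" where
  "ereal_integral S g =
    enn2ereal (\<integral>\<^sup>+t\<in>S. e2ennreal (g t) \<partial>lebesgue) -
    enn2ereal (\<integral>\<^sup>+t\<in>S. e2ennreal (- g t) \<partial>lebesgue)"

definition J\<^sub>P :: "(real \<Rightarrow> real) \<Rightarrow> (real \<Rightarrow> real) \<Rightarrow> ereal" where
  "J\<^sub>P u p = ereal_integral {0..1} (\<lambda>t. info_cost p t - ereal (u t * p t))"

definition optimal_solution :: "(real \<Rightarrow> real) \<Rightarrow> (real \<Rightarrow> real) \<Rightarrow> bool" where
  "optimal_solution u p \<longleftrightarrow>
    admissible p \<and> \<bar>J\<^sub>P u p\<bar> \<noteq> \<infinity> \<and> (\<forall>q. admissible q \<longrightarrow> J\<^sub>P u p \<le> J\<^sub>P u q)"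

definition interior_solution :: "(real \<Rightarrow> real) \<Rightarrow> bool" where
  "interior_solution p \<longleftrightarrow> (\<forall>t\<in>{0..1}. 0 < p t \<and> p t < 1)"

text \<open>\<open>p\<close> is differentiable on all of $[0,1]$ (one-sidedly at the end points) and its derivative has
  derivative \<open>d\<close> along \<open>F\<close>. Where the payoff jumps, the second derivative exists only from the
  left and from the right, which is why \<open>F\<close> is a parameter. At the end point \<open>0\<close>, where \<open>p'\<close>
  vanishes for an interior minimizer, the second derivative is a negative multiple of the right
  limit of the payoff at \<open>0\<close>; so if that limit is \<open>0\<close> (possible, by a jump, even when \<open>u 0 < 0\<close>),
  the second derivative is \<open>0\<close> there. The same holds at \<open>1\<close> with left limits.\<close>

definition has_second_derivative :: "(real \<Rightarrow> real) \<Rightarrow> real \<Rightarrow> real filter \<Rightarrow> bool" where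
  "has_second_derivative p d F \<longleftrightarrow>
    (\<exists>p'. (\<forall>t\<in>{0..1}. (p has_real_derivative p' t) (at t within {0..1})) \<and>
          (p' has_real_derivative d) F)"

end

(*
  Substituting p = (1 - cos \<theta>) / 2 turns the cost p'^2 / (p (1 - p)) into \<theta>'^2, so that an interior
  minimizer solves the pendulum equation \<theta>'' = - (u / 4) sin \<theta> with \<theta>'(0) = \<theta>'(1) = 0.  Shooting
  from \<theta>(0) = a, with a chosen such that \<theta>(1/2) = \<pi>/2, and reflecting gives a solution with
  \<theta>' > 0 inside (0,1).

  With \<lambda> = 2 \<theta>' / sin \<theta>, the inequality y^2 / H \<ge> 2 \<lambda> y - \<lambda>^2 H and the fundamental theorem of calculus
  for the absolutely continuous function 2 \<lambda> (q - p) show J[q] \<ge> J[p] + \<integral> \<lambda>^2 (q - p)^2 for every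
  admissible q, so p is the unique minimizer.  The signs are read off
  p'' = cos \<theta> \<theta>'^2 / 2 - u sin^2 \<theta> / 8.

  Absolutely continuous functions are differentiable almost everywhere by a Vitali argument: where
  arbitrarily short intervals have increments \<le> 0 and others slope \<ge> s > 0, cover the set by intervals
  of the first kind, and inside these by intervals of the second kind.  The gaps have small total
  length, hence a small total increment, which is impossible unless the set is null.
*)

theory Submission
  imports Defs
begin

subsection \<open>Absolutely continuous functions\<close>

text \<open>Optimality is verified directly instead of being derived from necessary conditions: a
  competitor \<open>q\<close> is differentiable only almost everywhere, may touch 0 and 1 and may
  have infinite cost. What makes this work is convexity: \<open>y^2 / H\<close> is convex in
  \<open>(y, H)\<close> and decreasing in \<open>H > 0\<close>, and \<open>q (1 - q)\<close> is
  concave, so the integrand is jointly convex in \<open>(q', q)\<close> and a stationary path is a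
  minimizer. As \<open>q (1 - q)\<close> is quadratic, its expansion about \<open>p\<close> is
  exact, and its second-order term is the source of \<open>\<lambda>^2 (q - p)^2\<close>. The end
  points of \<open>p\<close> are free; this gives the natural boundary conditions on
  \<open>\<theta>'\<close>, and these in turn make the boundary terms
  \<open>2 \<lambda> (q - p)\<close> vanish. The pendulum equation is the Euler-Lagrange equation of
  \<open>\<theta>'^2 - u (1 - cos \<theta>) / 2\<close>, whence the factor 1/4. Antisymmetry of
  \<open>u\<close> allows solving on the left half only: the condition at the midpoint is the one
  required by the reflection \<open>\<theta>(1 - t) = \<pi> - \<theta>(t)\<close>. An angle bounded
  away from 0 and \<open>\<pi>\<close> keeps \<open>\<lambda>\<close> Lipschitz, so that its product
  with an absolutely continuous function is again absolutely continuous.\<close>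

lemma abs_cont_on_separated:
  assumes "abs_cont_on a b f" "0 < e"
  obtains d where "0 < d"
    "\<forall>I. finite I \<and> (\<forall>i\<in>I. a \<le> fst i \<and> fst i \<le> snd i \<and> snd i \<le> b) \<and>
      pairwise (\<lambda>i j. snd i \<le> fst j \<or> snd j \<le> fst i) I \<and> (\<Sum>i\<in>I. snd i - fst i) < d
      \<longrightarrow> (\<Sum>i\<in>I. \<bar>f (snd i) - f (fst i)\<bar>) < e"
proof -
  obtain d where d: "0 < d" and *: "\<And>I. \<lbrakk>finite I; \<forall>(x, y)\<in>I. a \<le> x \<and> x \<le> y \<and> y \<le> b;
      disjoint_family_on (\<lambda>(x, y). {x<..<y}) I; (\<Sum>(x, y)\<in>I. y - x) < d\<rbrakk>
      \<Longrightarrow> (\<Sum>(x, y)\<in>I. \<bar>f y - f x\<bar>) < e"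
    using assms unfolding abs_cont_on_def by meson
  show thesis
  proof (rule that[OF d], intro allI impI; elim conjE)
    fix I :: "(real \<times> real) set"
    assume I: "finite I" "\<forall>i\<in>I. a \<le> fst i \<and> fst i \<le> snd i \<and> snd i \<le> b"
      "pairwise (\<lambda>i j. snd i \<le> fst j \<or> snd j \<le> fst i) I" "(\<Sum>i\<in>I. snd i - fst i) < d"
    \<comment> \<open>Separated end points give disjoint open intervals. The converse fails for
      degenerate pairs, so this form of the bound is weaker, but it is linear arithmetic on end
      points and survives the cutting of intervals.\<close>
    have "disjoint_family_on (\<lambda>(x, y). {x<..<y}) I"
      using I(3) unfolding disjoint_family_on_def pairwise_def by fastforce
    then show "(\<Sum>i\<in>I. \<bar>f (snd i) - f (fst i)\<bar>) < e"
      using *[of I] I by (simp add: case_prod_unfold)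
  qed
qed

text \<open>Increments dominated by those of \<open>f\<close> plus a Lipschitz part: this one
  comparison covers tilting by a line, the product \<open>lam (q - p)\<close> and, with
  \<open>f\<close> constant, Lipschitz functions.\<close>

lemma abs_cont_on_le:
  assumes f: "abs_cont_on a b f" and A: "0 \<le> A" and B: "0 \<le> B"
    and le: "\<And>x y. \<lbrakk>a \<le> x; x \<le> y; y \<le> b\<rbrakk> \<Longrightarrow> \<bar>g y - g x\<bar> \<le> A * \<bar>f y - f x\<bar> + B * (y - x)"
  shows "abs_cont_on a b g"
  unfolding abs_cont_on_def
proof (intro allI impI)
  fix e :: real
  assume e: "0 < e"
  \<comment> \<open>Half of \<open>e\<close> goes to the increments of \<open>f\<close>, half to the
    lengths; \<open>A + 1\<close> and \<open>B + 1\<close> keep the denominators positive when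
    \<open>A\<close> or \<open>B\<close> is 0.\<close>
  obtain d where d: "0 < d" and *: "\<And>I. \<lbrakk>finite I; \<forall>(x, y)\<in>I. a \<le> x \<and> x \<le> y \<and> y \<le> b;
      disjoint_family_on (\<lambda>(x, y). {x<..<y}) I; (\<Sum>(x, y)\<in>I. y - x) < d\<rbrakk>
      \<Longrightarrow> (\<Sum>(x, y)\<in>I. \<bar>f y - f x\<bar>) < e / (2 * (A + 1))"
  proof -
    have "0 < e / (2 * (A + 1))" using e A by simp
    then show ?thesis using that f unfolding abs_cont_on_def by meson
  qed
  define d' where "d' = min d (e / (2 * (B + 1)))"
  have "0 < d'" using d e B by (simp add: d'_def)
  moreover have "(\<Sum>(x, y)\<in>I. \<bar>g y - g x\<bar>) < e"
    if I: "finite I" "\<forall>(x, y)\<in>I. a \<le> x \<and> x \<le> y \<and> y \<le> b"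
      "disjoint_family_on (\<lambda>(x, y). {x<..<y}) I" "(\<Sum>(x, y)\<in>I. y - x) < d'" for I
  proof -
    let ?F = "\<Sum>(x, y)\<in>I. \<bar>f y - f x\<bar>" and ?L = "\<Sum>(x, y)\<in>I. y - x"
    have F: "?F < e / (2 * (A + 1))" and L: "?L < e / (2 * (B + 1))"
      using * I by (auto simp: d'_def)
    have "0 \<le> ?F" "0 \<le> ?L" using I(2) by (auto intro!: sum_nonneg)
    have "(\<Sum>(x, y)\<in>I. \<bar>g y - g x\<bar>) \<le> (\<Sum>(x, y)\<in>I. A * \<bar>f y - f x\<bar> + B * (y - x))"
      using I(2) le by (intro sum_mono) fastforce
    also have "\<dots> = A * ?F + B * ?L"
      by (simp add: case_prod_unfold sum.distrib sum_distrib_left)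
    also have "\<dots> \<le> (A + 1) * ?F + (B + 1) * ?L"
      using \<open>0 \<le> ?F\<close> \<open>0 \<le> ?L\<close> by (simp add: algebra_simps)
    also have "\<dots> < e / 2 + e / 2"
      using F L A B by (intro add_strict_mono) (simp_all add: field_simps)
    finally show ?thesis by simp
  qed
  ultimately show "\<exists>d>0. \<forall>I. finite I \<and> (\<forall>(x, y)\<in>I. a \<le> x \<and> x \<le> y \<and> y \<le> b) \<and>
      disjoint_family_on (\<lambda>(x, y). {x<..<y}) I \<and> (\<Sum>(x, y)\<in>I. y - x) < d \<longrightarrow>
      (\<Sum>(x, y)\<in>I. \<bar>g y - g x\<bar>) < e" by blast
qed

lemma abs_cont_on_imp_continuous_on:
  assumes f: "abs_cont_on a b f"
  shows "continuous_on {a..b} f"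
  unfolding continuous_on_iff
proof (intro ballI allI impI)
  fix x e :: real
  assume x: "x \<in> {a..b}" and e: "0 < e"
  obtain d where d: "0 < d" and *: "\<forall>I. finite I \<and> (\<forall>i\<in>I. a \<le> fst i \<and> fst i \<le> snd i \<and> snd i \<le> b) \<and>
      pairwise (\<lambda>i j. snd i \<le> fst j \<or> snd j \<le> fst i) I \<and> (\<Sum>i\<in>I. snd i - fst i) < d
      \<longrightarrow> (\<Sum>i\<in>I. \<bar>f (snd i) - f (fst i)\<bar>) < e"
    by (rule abs_cont_on_separated[OF f e])
  have "dist (f y) (f x) < e" if y: "y \<in> {a..b}" "dist y x < d" for y
  proof (cases "x \<le> y")
    case True
    then show ?thesis using *[rule_format, of "{(x, y)}"] x y by (simp add: dist_real_def)
  next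
    case False
    then show ?thesis using *[rule_format, of "{(y, x)}"] x y by (simp add: dist_real_def abs_minus_commute)
  qed
  then show "\<exists>d>0. \<forall>y\<in>{a..b}. dist y x < d \<longrightarrow> dist (f y) (f x) < e"
    using d by blast
qed

section \<open>Vitali coverings by intervals, and increments over the gaps\<close>

lemma finite_Vitali_intervals:
  fixes E :: "real set" and K :: "(real \<times> real) set"
  assumes K: "\<And>i. i \<in> K \<Longrightarrow> a \<le> fst i \<and> fst i < snd i \<and> snd i \<le> b"
    and cover: "\<And>x d. \<lbrakk>x \<in> E; 0 < d\<rbrakk> \<Longrightarrow> \<exists>i\<in>K. fst i \<le> x \<and> x \<le> snd i \<and> snd i - fst i < d"
    and e: "0 < e"
  obtains C T where "finite C" "C \<subseteq> K" "pairwise (\<lambda>i j. snd i < fst j \<or> snd j < fst i) C"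
    "T \<in> lmeasurable" "measure lebesgue T < e" "E \<subseteq> (\<Union>i\<in>C. {fst i..snd i}) \<union> T"
proof -
  let ?c = "\<lambda>i::real \<times> real. (fst i + snd i) / 2" and ?r = "\<lambda>i::real \<times> real. (snd i - fst i) / 2"
  have cb: "cball (?c i) (?r i) = {fst i..snd i}" for i
    by (auto simp: dist_real_def abs_le_iff field_simps)
  have r: "0 < ?r i" if "i \<in> K" for i using K[OF that] by simp
  have cov: "\<exists>i. i \<in> K \<and> x \<in> cball (?c i) (?r i) \<and> ?r i < d" if "x \<in> E" "0 < d" for x d
    using cover[OF that(1), of "2 * d"] that(2) unfolding cb by fastforce
  obtain C where C: "countable C" "C \<subseteq> K"
     "pairwise (\<lambda>i j. disjnt (cball (?c i) (?r i)) (cball (?c j) (?r j))) C"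
     "negligible (E - (\<Union>i\<in>C. cball (?c i) (?r i)))"
    using Vitali_covering_theorem_cballs[of K ?r E ?c, OF r cov] by blast
  let ?I = "\<lambda>i::real \<times> real. {fst i..snd i}"
  have sub: "\<Union>(?I ` C) \<subseteq> {a..b}" using K C(2) by fastforce
  have UC: "\<Union>(?I ` D) \<in> lmeasurable" if "D \<subseteq> C" for D
  proof -
    have "\<Union>(?I ` D) \<in> sets lebesgue"
      using countable_subset[OF that C(1)] by (intro sets.countable_UN') auto
    moreover have "bounded (\<Union>(?I ` D))"
      using sub that by (meson bounded_closed_interval bounded_subset UN_mono subset_refl)
    ultimately show ?thesis by (rule bounded_set_imp_lmeasurable[rotated])
  qed
  \<comment> \<open>The disjoint intervals of \<open>C\<close> lie in \<open>[a, b]\<close>, so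
    their union has finite measure and finitely many of them exhaust it up to
    \<open>e\<close>.\<close>
  obtain D' where D': "D' \<subseteq> ?I ` C" "finite D'"
    "measure lebesgue (\<Union>(?I ` C)) - e < measure lebesgue (\<Union>D')"
  proof (rule measure_countable_Union_approachable[of "?I ` C" e "measure lebesgue (\<Union>(?I ` C))"])
    show "measure lebesgue (\<Union>D') \<le> measure lebesgue (\<Union>(?I ` C))" if "D' \<subseteq> ?I ` C" "finite D'" for D'
    proof (rule measure_mono_fmeasurable)
      show "\<Union>D' \<in> sets lebesgue" using that by (intro sets.finite_Union) auto
    qed (use that UC in auto)
  qed (use C e in auto)
  then obtain F where F: "F \<subseteq> C" "finite F" "D' = ?I ` F"
    using finite_subset_image[OF D'(2,1)] by blast
  \<comment> \<open>The error set consists of the discarded intervals and the null set missed by the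
    Vitali family. Both are measurable even though \<open>E\<close> is arbitrary.\<close>
  define T where "T = (\<Union>(?I ` C) - \<Union>(?I ` F)) \<union> (E - \<Union>(?I ` C))"
  have neg: "negligible (E - \<Union>(?I ` C))" using C(4) unfolding cb .
  have *: "\<Union>(?I ` C) - \<Union>(?I ` F) \<in> lmeasurable"
    using UC[of C] UC[OF F(1)] by (simp add: fmeasurable.Diff)
  have "measure lebesgue T \<le> measure lebesgue (\<Union>(?I ` C) - \<Union>(?I ` F)) + measure lebesgue (E - \<Union>(?I ` C))"
    unfolding T_def using fmeasurableD[OF *] negligible_imp_sets[OF neg] by (intro measure_Un_le)
  also have "measure lebesgue (E - \<Union>(?I ` C)) = 0" using neg by (rule negligible_imp_measure0)
  also have "measure lebesgue (\<Union>(?I ` C) - \<Union>(?I ` F)) + 0 = measure lebesgue (\<Union>(?I ` C) - \<Union>(?I ` F))"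
    by simp
  also have "\<dots> = measure lebesgue (\<Union>(?I ` C)) - measure lebesgue (\<Union>(?I ` F))"
    using UC[of C] UC[OF F(1)] F(1) by (intro measurable_measure_Diff) auto
  also have "\<dots> < e" using D' F by simp
  finally have T: "measure lebesgue T < e" .
  show thesis
  proof (rule that[of F T])
    show "pairwise (\<lambda>i j. snd i < fst j \<or> snd j < fst i) F"
    proof (rule pairwiseI)
      fix i j assume ij: "i \<in> F" "j \<in> F" "i \<noteq> j"
      then have "disjnt {fst i..snd i} {fst j..snd j}" 
        using C(3) F(1) unfolding cb pairwise_def by blast
      moreover have "fst i < snd i" "fst j < snd j" using ij F(1) C(2) K by blast+
      ultimately show "snd i < fst j \<or> snd j < fst i"
        unfolding disjnt_iff by (metis atLeastAtMost_iff linorder_not_less nle_le order_less_imp_le)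
    qed
    show "T \<in> lmeasurable" unfolding T_def
      by (rule fmeasurable.Un[OF * negligible_imp_measurable[OF neg]])
  qed (use F C T in \<open>auto simp: T_def\<close>)
qed

lemma measure_Union_separated:
  fixes C :: "(real \<times> real) set"
  assumes "finite C" and "\<And>i. i \<in> C \<Longrightarrow> fst i \<le> snd i"
    and "pairwise (\<lambda>i j. snd i \<le> fst j \<or> snd j \<le> fst i) C"
  shows "measure lebesgue (\<Union>i\<in>C. {fst i..snd i}) = (\<Sum>i\<in>C. snd i - fst i)"
proof -
  have "measure lebesgue (\<Union>i\<in>C. {fst i..snd i}) = (\<Sum>i\<in>C. measure lebesgue {fst i..snd i})"
  proof (rule measure_negligible_finite_Union_image[OF assms(1)])
    show "pairwise (\<lambda>i j. negligible ({fst i..snd i} \<inter> {fst j..snd j})) C"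
    proof (rule pairwiseI)
      fix i j assume "i \<in> C" "j \<in> C" "i \<noteq> j"
      then have "snd i \<le> fst j \<or> snd j \<le> fst i" using assms(3) by (auto simp: pairwise_def)
      then have "{fst i..snd i} \<inter> {fst j..snd j} \<subseteq> {snd i, snd j}"
        by auto
      then show "negligible ({fst i..snd i} \<inter> {fst j..snd j})"
        by (meson finite.emptyI finite.insertI negligible_finite negligible_subset)
    qed
  qed auto
  also have "\<dots> = (\<Sum>i\<in>C. snd i - fst i)" using assms(2) by (intro sum.cong) auto
  finally show ?thesis .
qed

text \<open>Cutting \<open>d\<close> out of the interval \<open>c\<close> around it leaves two
  pieces whose increments add up to that of \<open>c\<close> minus that of \<open>d\<close>. A
  single family \<open>G\<close> serves every \<open>f\<close>, so that it can be measured both with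
  the identity, for lengths, and with the function under study.\<close>

lemma sum_gaps:
  fixes C D :: "(real \<times> real) set"
  assumes "finite D" "finite C" "\<And>i. i \<in> C \<Longrightarrow> a \<le> fst i \<and> fst i < snd i \<and> snd i \<le> b"
    "pairwise (\<lambda>i j. snd i \<le> fst j \<or> snd j \<le> fst i) C"
    "\<And>d. d \<in> D \<Longrightarrow> fst d < snd d \<and> (\<exists>c\<in>C. fst c < fst d \<and> snd d < snd c)"
    "pairwise (\<lambda>i j. snd i < fst j \<or> snd j < fst i) D"
  shows "\<exists>G. finite G \<and> (\<forall>i\<in>G. a \<le> fst i \<and> fst i < snd i \<and> snd i \<le> b) \<and>
    pairwise (\<lambda>i j. snd i \<le> fst j \<or> snd j \<le> fst i) G \<and>
    (\<forall>f::real \<Rightarrow> real. (\<Sum>i\<in>G. f (snd i) - f (fst i)) =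
       (\<Sum>i\<in>C. f (snd i) - f (fst i)) - (\<Sum>i\<in>D. f (snd i) - f (fst i)))"
  using assms
proof (induction D arbitrary: C rule: finite_induct)
  case empty
  then show ?case by (intro exI[of _ C]) auto
next
  case (insert d D)
  obtain c where c: "c \<in> C" "fst c < fst d" "snd d < snd c" "fst d < snd d"
    using insert.prems(4) by blast
  let ?l = "(fst c, fst d)" and ?r = "(snd d, snd c)"
  define C' where "C' = insert ?l (insert ?r (C - {c}))"
  have sep: "snd i \<le> fst c \<or> snd c \<le> fst i" if "i \<in> C" "i \<noteq> c" for i
    using insert.prems(3) that c(1) by (auto simp: pairwise_def)
  \<comment> \<open>The two pieces are really new elements and, by \<open>ne\<close>, distinct;
    otherwise the insertions would merge equal pairs and the sum would lose a term.\<close>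
  have new: "?l \<notin> C - {c}" "?r \<notin> C - {c}"
    using sep[of ?l] sep[of ?r] c by (auto simp: prod_eq_iff)
  have ne: "?l \<noteq> ?r" using c by auto
  have sum: "(\<Sum>i\<in>C'. f (snd i) - f (fst i)) =
      (\<Sum>i\<in>C. f (snd i) - f (fst i)) - (f (snd d) - f (fst d))" for f :: "real \<Rightarrow> real"
    using new ne insert.prems(1) c(1) unfolding C'_def
    by (simp add: sum.remove[OF insert.prems(1) c(1)])
  have "pairwise (\<lambda>i j. snd i \<le> fst j \<or> snd j \<le> fst i) C'"
    unfolding pairwise_def
  proof (intro ballI impI)
    fix i j assume ij: "i \<in> C'" "j \<in> C'" "i \<noteq> j"
    consider "i \<in> C - {c}" "j \<in> C - {c}" | "i \<in> {?l, ?r}" "j \<in> C - {c}"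
      | "i \<in> C - {c}" "j \<in> {?l, ?r}" | "i \<in> {?l, ?r}" "j \<in> {?l, ?r}"
      using ij unfolding C'_def by blast
    then show "snd i \<le> fst j \<or> snd j \<le> fst i"
    proof cases
      case 1
      then show ?thesis using insert.prems(3) ij(3) by (auto simp: pairwise_def)
    next
      case 2
      then show ?thesis using sep[of j] c by auto
    next
      case 3
      then show ?thesis using sep[of i] c by auto
    next
      case 4
      then show ?thesis using ij(3) c by auto
    qed
  qed
  moreover have "a \<le> fst i \<and> fst i < snd i \<and> snd i \<le> b" if "i \<in> C'" for i
    using that insert.prems(2)[of i] insert.prems(2)[OF c(1)] c unfolding C'_def by auto
  moreover have "fst e < snd e \<and> (\<exists>c\<in>C'. fst c < fst e \<and> snd e < snd c)" if e: "e \<in> D" for e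
  proof -
    obtain c' where c': "c' \<in> C" "fst c' < fst e" "snd e < snd c'" "fst e < snd e"
      using insert.prems(4)[of e] e by auto
    \<comment> \<open>Strict separation in \<open>D\<close> puts \<open>e\<close> strictly inside
      one of the two pieces when it lies in the interval that was cut.\<close>
    have "snd e < fst d \<or> snd d < fst e"
      using insert.prems(5) insert.hyps(2) e unfolding pairwise_def by (metis insert_iff)
    then show ?thesis using c' c unfolding C'_def by (cases "c' = c") auto
  qed
  moreover have "pairwise (\<lambda>i j. snd i < fst j \<or> snd j < fst i) D"
    using insert.prems(5) by (simp add: pairwise_insert)
  moreover have "finite C'" using insert.prems(1) by (simp add: C'_def)
  ultimately obtain G where "finite G" "\<forall>i\<in>G. a \<le> fst i \<and> fst i < snd i \<and> snd i \<le> b"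
    "pairwise (\<lambda>i j. snd i \<le> fst j \<or> snd j \<le> fst i) G"
    "\<forall>f::real \<Rightarrow> real. (\<Sum>i\<in>G. f (snd i) - f (fst i)) =
       (\<Sum>i\<in>C'. f (snd i) - f (fst i)) - (\<Sum>i\<in>D. f (snd i) - f (fst i))"
    using insert.IH[of C'] by blast
  then show ?case
    using insert.hyps by (intro exI[of _ G]) (auto simp: sum)
qed

text \<open>The number \<open>m\<close> is the outer measure of \<open>E\<close>. It is described by
  measurable supersets because \<open>E\<close> is not known to be measurable, so
  \<open>measure lebesgue E\<close> itself would carry no information.\<close>

lemma outer_measure_obtain:
  fixes E :: "real set"
  assumes "bounded E" "\<not> negligible E"
  obtains m where "0 < m" "\<forall>T. T \<in> lmeasurable \<and> E \<subseteq> T \<longrightarrow> m \<le> measure lebesgue T"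
    "\<forall>e>0. \<exists>T. open T \<and> T \<in> lmeasurable \<and> E \<subseteq> T \<and> measure lebesgue T < m + e"
proof -
  define M where "M = {measure lebesgue T |T. T \<in> lmeasurable \<and> E \<subseteq> T}"
  obtain a b where ab: "E \<subseteq> cbox a b" using assms(1) bounded_subset_cbox_symmetric by meson
  then have ne: "M \<noteq> {}" unfolding M_def by blast
  have bdd: "bdd_below M" unfolding M_def by (rule bdd_belowI[of _ 0]) auto
  have lower: "Inf M \<le> measure lebesgue T" if "T \<in> lmeasurable" "E \<subseteq> T" for T
    using that bdd by (intro cInf_lower) (auto simp: M_def)
  show thesis
  proof (rule that[of "Inf M"], goal_cases)
    case 1
    show "0 < Inf M"
    proof (rule ccontr)
      assume "\<not> 0 < Inf M"
      then have "\<exists>T. E \<subseteq> T \<and> T \<in> lmeasurable \<and> measure lebesgue T < e" if "0 < e" for e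
      proof -
        have "Inf M < e" using that \<open>\<not> 0 < Inf M\<close> by simp
        then obtain x where "x \<in> M" "x < e" using cInf_lessD[OF ne] by blast
        then show ?thesis unfolding M_def by blast
      qed
      then show False using assms(2) negligible_outer by blast
    qed
  next
    case 2
    then show ?case using lower by blast
  next
    case 3
    show ?case
    proof (intro allI impI)
      fix e :: real
      assume e: "0 < e"
      obtain S where S: "S \<in> lmeasurable" "E \<subseteq> S" "measure lebesgue S < Inf M + e / 2"
        using cInf_lessD[OF ne, of "Inf M + e / 2"] e unfolding M_def by auto
      obtain T where T: "open T" "S \<subseteq> T" "T - S \<in> lmeasurable" "emeasure lebesgue (T - S) < ennreal (e / 2)"
        using sets_lebesgue_outer_open[of S "e / 2"] S(1) e by auto
      have TS: "T = (T - S) \<union> S" using T(2) by auto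
      have "measure lebesgue (T - S) < e / 2"
        using T(3,4) e by (simp add: emeasure_eq_measure2 ennreal_less_iff)
      moreover have "measure lebesgue T \<le> measure lebesgue (T - S) + measure lebesgue S"
        by (subst TS, rule measure_Un_le) (use S T in auto)
      moreover have "T \<in> lmeasurable" by (subst TS, rule fmeasurable.Un[OF T(3) S(1)])
      ultimately show "\<exists>T. open T \<and> T \<in> lmeasurable \<and> E \<subseteq> T \<and> measure lebesgue T < Inf M + e"
        using S T by (intro exI[of _ T]) auto
    qed
  qed
qed

text \<open>Applied to a function tilted by a line, this excludes difference quotients that
  oscillate across a gap between two slopes. Lengths are compared with the outer measure of
  \<open>E\<close>.\<close>

lemma negligible_two_slopes:
  assumes f: "abs_cont_on a b f" and s: "0 < s" and E: "E \<subseteq> {a..b}"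
    and down: "\<And>x d. \<lbrakk>x \<in> E; 0 < d\<rbrakk> \<Longrightarrow> \<exists>i. a \<le> fst i \<and> fst i < snd i \<and> snd i \<le> b \<and>
      fst i \<le> x \<and> x \<le> snd i \<and> snd i - fst i < d \<and> f (snd i) \<le> f (fst i)"
    and up: "\<And>x d. \<lbrakk>x \<in> E; 0 < d\<rbrakk> \<Longrightarrow> \<exists>i. a \<le> fst i \<and> fst i < snd i \<and> snd i \<le> b \<and>
      fst i \<le> x \<and> x \<le> snd i \<and> snd i - fst i < d \<and> s * (snd i - fst i) \<le> f (snd i) - f (fst i)"
  shows "negligible E"
proof (rule ccontr)
  assume neg: "\<not> negligible E"
  have "bounded E" using E bounded_closed_interval bounded_subset by blast
  then obtain m where m: "0 < m" "\<forall>T. T \<in> lmeasurable \<and> E \<subseteq> T \<longrightarrow> m \<le> measure lebesgue T"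
    "\<forall>e>0. \<exists>T. open T \<and> T \<in> lmeasurable \<and> E \<subseteq> T \<and> measure lebesgue T < m + e"
    by (rule outer_measure_obtain[OF _ neg])
  have "0 < s * m / 2" using s m(1) by simp
  then obtain \<delta> where \<delta>: "0 < \<delta>" and ac: "\<forall>I. finite I \<and> (\<forall>i\<in>I. a \<le> fst i \<and> fst i \<le> snd i \<and> snd i \<le> b) \<and>
      pairwise (\<lambda>i j. snd i \<le> fst j \<or> snd j \<le> fst i) I \<and> (\<Sum>i\<in>I. snd i - fst i) < \<delta>
      \<longrightarrow> (\<Sum>i\<in>I. \<bar>f (snd i) - f (fst i)\<bar>) < s * m / 2"
    by (rule abs_cont_on_separated[OF f])
  \<comment> \<open>The outer family \<open>C\<close> lies in \<open>W\<close>, so its length is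
    below \<open>m + e\<close>; the inner family \<open>D\<close> misses only parts of
    \<open>T\<close> and \<open>U\<close> and end points, so its length is above
    \<open>m - 2 * e\<close>. Hence the gaps are shorter than \<open>3 * e < \<delta>\<close>, while
    \<open>D\<close> stays longer than \<open>m / 2\<close>.\<close>
  define e where "e = min (m / 4) (\<delta> / 4)"
  have e: "0 < e" "4 * e \<le> m" "4 * e \<le> \<delta>" using m(1) \<delta> by (auto simp: e_def)
  obtain W where W: "open W" "W \<in> lmeasurable" "E \<subseteq> W" "measure lebesgue W < m + e"
    using m(3) e(1) by blast
  define K where "K = {i. a \<le> fst i \<and> fst i < snd i \<and> snd i \<le> b \<and> {fst i..snd i} \<subseteq> W \<and> f (snd i) \<le> f (fst i)}"
  have covK: "\<exists>i\<in>K. fst i \<le> x \<and> x \<le> snd i \<and> snd i - fst i < d" if x: "x \<in> E" and d: "0 < d" for x d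
  proof -
    obtain r where r: "0 < r" "ball x r \<subseteq> W" using W(1,3) x openE by blast
    obtain i where i: "a \<le> fst i \<and> fst i < snd i \<and> snd i \<le> b \<and>
      fst i \<le> x \<and> x \<le> snd i \<and> snd i - fst i < min d r \<and> f (snd i) \<le> f (fst i)"
      using down[OF x, of "min d r"] d r(1) by auto
    then have "{fst i..snd i} \<subseteq> ball x r" by (auto simp: dist_real_def)
    then show ?thesis using i r(2) unfolding K_def by (intro bexI[of _ i]) auto
  qed
  have bdK: "a \<le> fst i \<and> fst i < snd i \<and> snd i \<le> b" if "i \<in> K" for i
    using that unfolding K_def by simp
  obtain C T where C: "finite C" "C \<subseteq> K" "pairwise (\<lambda>i j. snd i < fst j \<or> snd j < fst i) C"
    and T: "T \<in> lmeasurable" "measure lebesgue T < e" "E \<subseteq> (\<Union>i\<in>C. {fst i..snd i}) \<union> T"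
    by (rule finite_Vitali_intervals[of K a b, OF bdK covK e(1)])
  have Cle: "fst c < snd c" "a \<le> fst c" "snd c \<le> b" "{fst c..snd c} \<subseteq> W" "f (snd c) \<le> f (fst c)" if "c \<in> C" for c
    using that C(2) unfolding K_def by auto
  define L where "L = {i. a \<le> fst i \<and> fst i < snd i \<and> snd i \<le> b \<and> (\<exists>c\<in>C. fst c < fst i \<and> snd i < snd c) \<and>
    s * (snd i - fst i) \<le> f (snd i) - f (fst i)}"
  \<comment> \<open>The end points of the intervals of \<open>C\<close> are left out, so that the
    second covering nests strictly inside \<open>C\<close>; they form the finite set
    \<open>Z\<close> below.\<close>
  define E' where "E' = E \<inter> (\<Union>c\<in>C. {fst c<..<snd c})"
  have covL: "\<exists>i\<in>L. fst i \<le> x \<and> x \<le> snd i \<and> snd i - fst i < d" if x: "x \<in> E'" and d: "0 < d" for x d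
  proof -
    obtain c where c: "c \<in> C" "fst c < x" "x < snd c" "x \<in> E" using x unfolding E'_def by auto
    obtain i where i: "a \<le> fst i \<and> fst i < snd i \<and> snd i \<le> b \<and>
      fst i \<le> x \<and> x \<le> snd i \<and> snd i - fst i < min d (min (x - fst c) (snd c - x)) \<and>
      s * (snd i - fst i) \<le> f (snd i) - f (fst i)"
      using up[OF c(4), of "min d (min (x - fst c) (snd c - x))"] d c by auto
    then have "fst c < fst i" "snd i < snd c" by auto
    then have "i \<in> L" using i c(1) unfolding L_def by blast
    then show ?thesis using i by auto
  qed
  have bdL: "a \<le> fst i \<and> fst i < snd i \<and> snd i \<le> b" if "i \<in> L" for i
    using that unfolding L_def by simp
  obtain D U where D: "finite D" "D \<subseteq> L" "pairwise (\<lambda>i j. snd i < fst j \<or> snd j < fst i) D"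
    and U: "U \<in> lmeasurable" "measure lebesgue U < e" "E' \<subseteq> (\<Union>i\<in>D. {fst i..snd i}) \<union> U"
    by (rule finite_Vitali_intervals[of L a b, OF bdL covL e(1)])
  have Dle: "fst d < snd d" "\<exists>c\<in>C. fst c < fst d \<and> snd d < snd c" 
    "s * (snd d - fst d) \<le> f (snd d) - f (fst d)" if "d \<in> D" for d
    using that D(2) unfolding L_def by auto
  have C': "pairwise (\<lambda>i j. snd i \<le> fst j \<or> snd j \<le> fst i) C"
    and D': "pairwise (\<lambda>i j. snd i \<le> fst j \<or> snd j \<le> fst i) D"
    by (rule pairwise_mono[OF C(3) _ order_refl] pairwise_mono[OF D(3) _ order_refl]; auto)+
  have "\<exists>G. finite G \<and> (\<forall>i\<in>G. a \<le> fst i \<and> fst i < snd i \<and> snd i \<le> b) \<and>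
    pairwise (\<lambda>i j. snd i \<le> fst j \<or> snd j \<le> fst i) G \<and>
    (\<forall>f::real \<Rightarrow> real. (\<Sum>i\<in>G. f (snd i) - f (fst i)) =
       (\<Sum>i\<in>C. f (snd i) - f (fst i)) - (\<Sum>i\<in>D. f (snd i) - f (fst i)))"
  proof (rule sum_gaps[OF D(1) C(1) _ C' _ D(3)])
    show "a \<le> fst i \<and> fst i < snd i \<and> snd i \<le> b" if "i \<in> C" for i using Cle[OF that] by simp
    show "fst d < snd d \<and> (\<exists>c\<in>C. fst c < fst d \<and> snd d < snd c)" if "d \<in> D" for d
      using Dle(1,2)[OF that] by blast
  qed
  then obtain G where G: "finite G" "\<forall>i\<in>G. a \<le> fst i \<and> fst i < snd i \<and> snd i \<le> b"
    "pairwise (\<lambda>i j. snd i \<le> fst j \<or> snd j \<le> fst i) G"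
    and Gs: "\<And>f::real \<Rightarrow> real. (\<Sum>i\<in>G. f (snd i) - f (fst i)) =
       (\<Sum>i\<in>C. f (snd i) - f (fst i)) - (\<Sum>i\<in>D. f (snd i) - f (fst i))"
    by blast
  have "(\<Sum>i\<in>C. snd i - fst i) = measure lebesgue (\<Union>i\<in>C. {fst i..snd i})"
    using Cle(1) by (intro measure_Union_separated[symmetric] C(1) C') (simp add: less_imp_le)
  also have "\<dots> \<le> measure lebesgue W"
    using C(1) Cle(4) W(2) by (intro measure_mono_fmeasurable) auto
  finally have mC: "(\<Sum>i\<in>C. snd i - fst i) < m + e" using W(4) by simp
  define Z where "Z = fst ` C \<union> snd ` C"
  have Z: "negligible Z" unfolding Z_def using C(1) by (intro negligible_finite) auto
  let ?D = "\<Union>i\<in>D. {fst i..snd i}"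
  have D_meas: "?D \<in> lmeasurable" using D(1) by (intro fmeasurable.finite_UN) auto
  have "E \<subseteq> ?D \<union> (U \<union> (T \<union> Z))"
  proof
    fix x assume x: "x \<in> E"
    show "x \<in> ?D \<union> (U \<union> (T \<union> Z))"
    proof (cases "x \<in> T \<union> Z")
      case False
      then obtain c where "c \<in> C" "fst c \<le> x" "x \<le> snd c" using T(3) x by auto
      moreover then have "x \<noteq> fst c" "x \<noteq> snd c" using False unfolding Z_def by auto
      ultimately have "x \<in> E'" using x unfolding E'_def by force
      then show ?thesis using U(3) by blast
    qed auto
  qed
  then have "m \<le> measure lebesgue (?D \<union> (U \<union> (T \<union> Z)))"
    using D_meas U(1) T(1) negligible_imp_measurable[OF Z] by (intro m(2)[rule_format] conjI fmeasurable.Un)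
  also have "\<dots> \<le> measure lebesgue ?D + (measure lebesgue U + (measure lebesgue T + measure lebesgue Z))"
    using D_meas U(1) T(1) negligible_imp_measurable[OF Z]
    by (intro order_trans[OF measure_Un_le] add_left_mono fmeasurableD fmeasurable.Un order_refl)
  also have "\<dots> < measure lebesgue ?D + 2 * e"
    using U(2) T(2) negligible_imp_measure0[OF Z] by simp
  also have "measure lebesgue ?D = (\<Sum>i\<in>D. snd i - fst i)"
    using Dle(1) by (intro measure_Union_separated D(1) D') (simp add: less_imp_le)
  finally have mD: "m < (\<Sum>i\<in>D. snd i - fst i) + 2 * e" .
  have "(\<Sum>i\<in>G. snd i - fst i) < 4 * e" using Gs[of "\<lambda>x. x"] mC mD e(1) by simp
  then have "(\<Sum>i\<in>G. \<bar>f (snd i) - f (fst i)\<bar>) < s * m / 2"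
    using G e(3) by (intro ac[rule_format]) (auto simp: less_imp_le)
  moreover have "- (\<Sum>i\<in>G. \<bar>f (snd i) - f (fst i)\<bar>) \<le> (\<Sum>i\<in>G. f (snd i) - f (fst i))"
    unfolding sum_negf[symmetric] by (intro sum_mono) simp
  moreover have "(\<Sum>i\<in>C. f (snd i) - f (fst i)) \<le> 0"
    using Cle(5) by (intro sum_nonpos) simp
  moreover have "s * (\<Sum>i\<in>D. snd i - fst i) \<le> (\<Sum>i\<in>D. f (snd i) - f (fst i))"
    unfolding sum_distrib_left using Dle(3) by (intro sum_mono) simp
  ultimately have "s * (\<Sum>i\<in>D. snd i - fst i) < s * m / 2"
    using Gs[of f] by linarith
  then have "(\<Sum>i\<in>D. snd i - fst i) < m / 2" using s by (simp add: field_simps)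
  then show False using mD e(2) by simp
qed

text \<open>Short steep intervals covering a set of positive outer measure would accumulate a larger
  increment than absolute continuity allows.\<close>

lemma negligible_infinite_slope:
  assumes f: "abs_cont_on a b f" and E: "E \<subseteq> {a<..<b}"
    and steep: "\<And>x k d. \<lbrakk>x \<in> E; 0 < d\<rbrakk> \<Longrightarrow> \<exists>i. a \<le> fst i \<and> fst i < snd i \<and> snd i \<le> b \<and>
      fst i \<le> x \<and> x \<le> snd i \<and> snd i - fst i < d \<and> k * (snd i - fst i) \<le> \<bar>f (snd i) - f (fst i)\<bar>"
  shows "negligible E"
proof -
  obtain \<delta> where \<delta>: "0 < \<delta>" and ac: "\<forall>I. finite I \<and> (\<forall>i\<in>I. a \<le> fst i \<and> fst i \<le> snd i \<and> snd i \<le> b) \<and>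
      pairwise (\<lambda>i j. snd i \<le> fst j \<or> snd j \<le> fst i) I \<and> (\<Sum>i\<in>I. snd i - fst i) < \<delta>
      \<longrightarrow> (\<Sum>i\<in>I. \<bar>f (snd i) - f (fst i)\<bar>) < 1"
    by (rule abs_cont_on_separated[OF f zero_less_one])
  \<comment> \<open>Any separated family inside one of these windows is shorter than
    \<open>\<delta>\<close> in total, so absolute continuity applies to all of it at once. The
    windows with rational left end cover the line.\<close>
  define J where "J q = {q<..<q + \<delta> / 2}" for q
  have neg: "negligible (E \<inter> J q)" for q
  proof (rule ccontr)
    assume neg: "\<not> negligible (E \<inter> J q)"
    have "E \<inter> J q \<subseteq> {a..b}" using E by auto
    then have "bounded (E \<inter> J q)" using bounded_closed_interval bounded_subset by blast
    then obtain m where m: "0 < m" "\<forall>T. T \<in> lmeasurable \<and> E \<inter> J q \<subseteq> T \<longrightarrow> m \<le> measure lebesgue T"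
      by (rule outer_measure_obtain[OF _ neg])
    \<comment> \<open>Slope \<open>k\<close> over a total length above \<open>m / 2\<close> forces a
      total increment above 1.\<close>
    define k where "k = 2 / m"
    define K where "K = {i. a \<le> fst i \<and> fst i < snd i \<and> snd i \<le> b \<and> {fst i..snd i} \<subseteq> J q \<and>
      k * (snd i - fst i) \<le> \<bar>f (snd i) - f (fst i)\<bar>}"
    have covK: "\<exists>i\<in>K. fst i \<le> x \<and> x \<le> snd i \<and> snd i - fst i < d" if x: "x \<in> E \<inter> J q" and d: "0 < d" for x d
    proof -
      have "open (J q)" unfolding J_def by simp
      then obtain r where r: "0 < r" "ball x r \<subseteq> J q" using x openE by blast
      obtain i where i: "a \<le> fst i \<and> fst i < snd i \<and> snd i \<le> b \<and>
        fst i \<le> x \<and> x \<le> snd i \<and> snd i - fst i < min d r \<and> k * (snd i - fst i) \<le> \<bar>f (snd i) - f (fst i)\<bar>"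
        using steep[of x "min d r" k] x d r(1) by (metis IntD1 min_less_iff_conj)
      then have "{fst i..snd i} \<subseteq> ball x r" by (auto simp: dist_real_def)
      then show ?thesis using i r(2) unfolding K_def by (intro bexI[of _ i]) auto
    qed
    have bdK: "a \<le> fst i \<and> fst i < snd i \<and> snd i \<le> b" if "i \<in> K" for i
      using that unfolding K_def by simp
    have "0 < m / 2" using m(1) by simp
    obtain D T where D: "finite D" "D \<subseteq> K" "pairwise (\<lambda>i j. snd i < fst j \<or> snd j < fst i) D"
      and T: "T \<in> lmeasurable" "measure lebesgue T < m / 2" "E \<inter> J q \<subseteq> (\<Union>i\<in>D. {fst i..snd i}) \<union> T"
      by (rule finite_Vitali_intervals[of K a b, OF bdK covK \<open>0 < m / 2\<close>])
    have Dle: "fst d < snd d" "a \<le> fst d" "snd d \<le> b" "{fst d..snd d} \<subseteq> J q"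
      "k * (snd d - fst d) \<le> \<bar>f (snd d) - f (fst d)\<bar>" if "d \<in> D" for d
      using that D(2) unfolding K_def by auto
    have D': "pairwise (\<lambda>i j. snd i \<le> fst j \<or> snd j \<le> fst i) D"
      by (rule pairwise_mono[OF D(3) _ order_refl]) auto
    let ?D = "\<Union>i\<in>D. {fst i..snd i}"
    have D_meas: "?D \<in> lmeasurable" using D(1) by (intro fmeasurable.finite_UN) auto
    have mD: "measure lebesgue ?D = (\<Sum>i\<in>D. snd i - fst i)"
      using Dle(1) by (intro measure_Union_separated D(1) D') (simp add: less_imp_le)
    have "m \<le> measure lebesgue (?D \<union> T)"
      using D_meas T by (intro m(2)[rule_format] conjI fmeasurable.Un)
    also have "\<dots> \<le> measure lebesgue ?D + measure lebesgue T"
      using D_meas T(1) by (intro measure_Un_le) auto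
    finally have "m / 2 < (\<Sum>i\<in>D. snd i - fst i)" using T(2) mD by simp
    then have "1 < k * (\<Sum>i\<in>D. snd i - fst i)" using m(1) by (simp add: k_def field_simps)
    also have "\<dots> \<le> (\<Sum>i\<in>D. \<bar>f (snd i) - f (fst i)\<bar>)"
      unfolding sum_distrib_left using Dle(5) by (intro sum_mono) simp
    also have "\<dots> < 1"
    proof (rule ac[rule_format], intro conjI ballI)
      have "measure lebesgue ?D \<le> measure lebesgue (J q)"
        using Dle(4) D_meas by (intro measure_mono_fmeasurable) (auto simp: J_def)
      also have "\<dots> < \<delta>" using \<delta> by (simp add: J_def)
      finally show "(\<Sum>i\<in>D. snd i - fst i) < \<delta>" using mD by simp
    qed (use D(1) D' Dle in \<open>auto simp: less_imp_le\<close>)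
    finally show False .
  qed
  have "negligible (\<Union>q\<in>\<rat>. E \<inter> J q)"
    by (intro negligible_countable_Union) (auto simp: neg countable_rat)
  moreover have "E \<subseteq> (\<Union>q\<in>\<rat>. E \<inter> J q)"
  proof
    fix x assume "x \<in> E"
    moreover obtain q where "q \<in> \<rat>" "x - \<delta> / 2 < q" "q < x"
      using Rats_dense_in_real[of "x - \<delta> / 2" x] \<delta> by auto
    ultimately show "x \<in> (\<Union>q\<in>\<rat>. E \<inter> J q)" unfolding J_def by force
  qed
  ultimately show ?thesis by (rule negligible_subset)
qed

text \<open>The limit is the limes superior, the infimum of the eventual upper bounds: a rational
  below it is no such bound, so every smaller rational is an eventual lower bound. Restricting
  \<open>r\<close> and \<open>s\<close> to rationals leaves only countably many exceptional sets in
  the application.\<close>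

lemma tendsto_if_no_oscillation:
  fixes Q :: "'a \<Rightarrow> real"
  assumes F: "F \<noteq> bot" and bdd: "eventually (\<lambda>y. \<bar>Q y\<bar> \<le> K) F"
    and osc: "\<And>r s. \<lbrakk>r \<in> \<rat>; s \<in> \<rat>; r < s\<rbrakk> \<Longrightarrow> eventually (\<lambda>y. r \<le> Q y) F \<or> eventually (\<lambda>y. Q y \<le> s) F"
  shows "\<exists>L. (Q \<longlongrightarrow> L) F"
proof -
  define S where "S = {s. eventually (\<lambda>y. Q y \<le> s) F}"
  have "K \<in> S" using bdd unfolding S_def by (auto elim: eventually_mono)
  moreover have lb: "- K \<le> s" if "s \<in> S" for s
  proof -
    have "eventually (\<lambda>y. - K \<le> s) F"
      using bdd that unfolding S_def mem_Collect_eq by eventually_elim auto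
    then show ?thesis using F by (simp add: eventually_const)
  qed
  ultimately have ne: "S \<noteq> {}" and bdd': "bdd_below S" by (blast, intro bdd_belowI[of S "- K"])
  have "(Q \<longlongrightarrow> Inf S) F"
  proof (rule order_tendstoI)
    fix l assume "l < Inf S"
    then obtain s where s: "s \<in> \<rat>" "l < s" "s < Inf S" using Rats_dense_in_real by blast
    obtain r where r: "r \<in> \<rat>" "l < r" "r < s" using Rats_dense_in_real[OF s(2)] by blast
    have "s \<notin> S" using s(3) cInf_lower[OF _ bdd'] by force
    then have "eventually (\<lambda>y. r \<le> Q y) F" using osc[OF r(1) s(1) r(3)] unfolding S_def by simp
    then show "eventually (\<lambda>y. l < Q y) F" using r(2) by (auto elim: eventually_mono)
  next
    fix l assume "Inf S < l"
    then obtain s where "s \<in> S" "s < l" using cInf_lessD[OF ne] by blast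
    then show "eventually (\<lambda>y. Q y < l) F" unfolding S_def by (auto elim: eventually_mono)
  qed
  then show ?thesis ..
qed

lemma not_eventually_at_interval:
  fixes x :: real
  assumes "\<not> eventually P (at x)" "a < x" "x < b" "0 < d"
  obtains y where "y \<noteq> x" "\<not> P y" "\<bar>y - x\<bar> < d" "a \<le> y" "y \<le> b"
proof -
  define e where "e = Min {d, x - a, b - x}"
  have "0 < e" using assms by (simp add: e_def)
  then obtain y where "y \<noteq> x" "\<not> P y" "dist y x < e"
    using assms(1) unfolding eventually_at by blast
  then show thesis using that[of y] by (auto simp: e_def dist_real_def)
qed

theorem abs_cont_on_differentiable_ae:
  assumes f: "abs_cont_on a b f"
  shows "negligible {x \<in> {a<..<b}. \<not> f differentiable at x}"
proof -
  let ?Q = "\<lambda>x y. (f y - f x) / (y - x)"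
  \<comment> \<open>The point \<open>x\<close> is an end point of the interval, so the slope over it
    is the difference quotient at \<open>x\<close>, on whichever side \<open>y\<close> lies.\<close>
  have interval: "a \<le> min x y \<and> min x y < max x y \<and> max x y \<le> b \<and> min x y \<le> x \<and> x \<le> max x y \<and>
      max x y - min x y < d \<and> f (max x y) - f (min x y) = ?Q x y * (max x y - min x y)"
    if "a < x" "x < b" "y \<noteq> x" "\<bar>y - x\<bar> < d" "a \<le> y" "y \<le> b" for x y d
    using that by (cases "x < y") (auto simp: min_def max_def field_simps)
  \<comment> \<open>A derivative can fail to exist in two ways: the quotients are unbounded near
    \<open>x\<close> (\<open>B\<close>), or they fall below \<open>r\<close> and exceed
    \<open>s\<close> arbitrarily close to \<open>x\<close> (\<open>O' r s\<close>).\<close>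
  define B where "B = {x \<in> {a<..<b}. \<forall>k. \<not> eventually (\<lambda>y. \<bar>?Q x y\<bar> \<le> k) (at x)}"
  define O' where "O' r s = {x \<in> {a<..<b}. \<not> eventually (\<lambda>y. r \<le> ?Q x y) (at x) \<and>
    \<not> eventually (\<lambda>y. ?Q x y \<le> s) (at x)}" for r s
  have "negligible B"
  proof (rule negligible_infinite_slope[OF f])
    fix x k d :: real assume "x \<in> B" "0 < d"
    then have x: "a < x" "x < b" "\<not> eventually (\<lambda>y. \<bar>?Q x y\<bar> \<le> k) (at x)" unfolding B_def by auto
    obtain y where y: "y \<noteq> x" "\<not> \<bar>?Q x y\<bar> \<le> k" "\<bar>y - x\<bar> < d" "a \<le> y" "y \<le> b"
      using not_eventually_at_interval[OF x(3,1,2) \<open>0 < d\<close>] by blast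
    have "k * (max x y - min x y) \<le> \<bar>?Q x y\<bar> * (max x y - min x y)"
      using y(2) by (intro mult_right_mono) auto
    also have "\<dots> = \<bar>?Q x y * (max x y - min x y)\<bar>" by (simp add: abs_mult)
    also have "\<dots> = \<bar>f (max x y) - f (min x y)\<bar>"
      using interval[OF x(1,2) y(1,3-5)] by simp
    finally have *: "k * (max x y - min x y) \<le> \<bar>f (max x y) - f (min x y)\<bar>" .
    show "\<exists>i. a \<le> fst i \<and> fst i < snd i \<and> snd i \<le> b \<and>
      fst i \<le> x \<and> x \<le> snd i \<and> snd i - fst i < d \<and> k * (snd i - fst i) \<le> \<bar>f (snd i) - f (fst i)\<bar>"
      using interval[OF x(1,2) y(1,3-5)] * by (intro exI[of _ "(min x y, max x y)"]) simp
  qed (auto simp: B_def)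
  moreover have "negligible (O' r s)" if rs: "r < s" for r s
  \<comment> \<open>Tilting by \<open>r\<close> turns quotients below \<open>r\<close> into
    intervals without increase, and quotients above \<open>s\<close> into slopes of at least
    \<open>s - r\<close>.\<close>
  proof (rule negligible_two_slopes[of a b "\<lambda>x. f x - r * x" "s - r"])
    show "abs_cont_on a b (\<lambda>x. f x - r * x)"
    proof (rule abs_cont_on_le[OF f, of 1 "\<bar>r\<bar>"])
      fix x y :: real assume "x \<le> y"
      have "f y - r * y - (f x - r * x) = (f y - f x) - r * (y - x)" by (simp add: algebra_simps)
      also have "\<bar>\<dots>\<bar> \<le> \<bar>f y - f x\<bar> + \<bar>r * (y - x)\<bar>" by (rule abs_triangle_ineq4)
      finally show "\<bar>f y - r * y - (f x - r * x)\<bar> \<le> 1 * \<bar>f y - f x\<bar> + \<bar>r\<bar> * (y - x)"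
        using \<open>x \<le> y\<close> by (simp add: abs_mult)
    qed auto
    fix x d :: real assume "x \<in> O' r s" and d: "0 < d"
    then have x: "a < x" "x < b" "\<not> eventually (\<lambda>y. r \<le> ?Q x y) (at x)"
      "\<not> eventually (\<lambda>y. ?Q x y \<le> s) (at x)" unfolding O'_def by auto
    obtain y where y: "y \<noteq> x" "\<not> r \<le> ?Q x y" "\<bar>y - x\<bar> < d" "a \<le> y" "y \<le> b"
      using not_eventually_at_interval[OF x(3,1,2) d] by blast
    have "?Q x y * (max x y - min x y) \<le> r * (max x y - min x y)"
      using y(2) by (intro mult_right_mono) auto
    then show "\<exists>i. a \<le> fst i \<and> fst i < snd i \<and> snd i \<le> b \<and> fst i \<le> x \<and> x \<le> snd i \<and>
      snd i - fst i < d \<and> f (snd i) - r * snd i \<le> f (fst i) - r * fst i"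
      using interval[OF x(1,2) y(1,3-5)]
      by (intro exI[of _ "(min x y, max x y)"]) (simp add: algebra_simps)
    obtain z where z: "z \<noteq> x" "\<not> ?Q x z \<le> s" "\<bar>z - x\<bar> < d" "a \<le> z" "z \<le> b"
      using not_eventually_at_interval[OF x(4,1,2) d] by blast
    have "s * (max x z - min x z) \<le> ?Q x z * (max x z - min x z)"
      using z(2) by (intro mult_right_mono) auto
    then show "\<exists>i. a \<le> fst i \<and> fst i < snd i \<and> snd i \<le> b \<and> fst i \<le> x \<and> x \<le> snd i \<and>
      snd i - fst i < d \<and> (s - r) * (snd i - fst i) \<le> f (snd i) - r * snd i - (f (fst i) - r * fst i)"
      using interval[OF x(1,2) z(1,3-5)]
      by (intro exI[of _ "(min x z, max x z)"]) (simp add: algebra_simps)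
  qed (use rs in \<open>auto simp: O'_def\<close>)
  then have "negligible (\<Union>p\<in>{(r, s). r \<in> \<rat> \<and> s \<in> \<rat> \<and> r < s}. O' (fst p) (snd p))"
  proof (intro negligible_countable_Union countable_image)
    have "{(r, s). r \<in> \<rat> \<and> s \<in> \<rat> \<and> r < (s::real)} \<subseteq> \<rat> \<times> \<rat>" by auto
    then show "countable {(r, s). r \<in> \<rat> \<and> s \<in> \<rat> \<and> r < (s::real)}"
      by (rule countable_subset) (intro countable_SIGMA countable_rat)
  qed auto
  ultimately have "negligible (B \<union> (\<Union>p\<in>{(r, s). r \<in> \<rat> \<and> s \<in> \<rat> \<and> r < s}. O' (fst p) (snd p)))"
    by (rule negligible_Un)
  moreover have "{x \<in> {a<..<b}. \<not> f differentiable at x} \<subseteq>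
    B \<union> (\<Union>p\<in>{(r, s). r \<in> \<rat> \<and> s \<in> \<rat> \<and> r < s}. O' (fst p) (snd p))"
  proof (rule subsetI, rule ccontr)
    fix x assume x: "x \<in> {x \<in> {a<..<b}. \<not> f differentiable at x}"
      and n: "x \<notin> B \<union> (\<Union>p\<in>{(r, s). r \<in> \<rat> \<and> s \<in> \<rat> \<and> r < s}. O' (fst p) (snd p))"
    obtain k where k: "eventually (\<lambda>y. \<bar>?Q x y\<bar> \<le> k) (at x)" using x n unfolding B_def by auto
    have "\<exists>L. (?Q x \<longlongrightarrow> L) (at x)"
    proof (rule tendsto_if_no_oscillation[OF _ k])
      fix r s :: real assume "r \<in> \<rat>" "s \<in> \<rat>" "r < s"
      then have "x \<notin> O' r s" using n by force
      then show "eventually (\<lambda>y. r \<le> ?Q x y) (at x) \<or> eventually (\<lambda>y. ?Q x y \<le> s) (at x)"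
        using x unfolding O'_def by auto
    qed auto
    then have "f differentiable at x"
      by (auto simp: has_field_derivative_iff real_differentiable_def)
    then show False using x by auto
  qed
  ultimately show ?thesis by (rule negligible_subset)
qed

text \<open>Riemann sums are estimated directly, so integrability of \<open>f'\<close> is a
  conclusion. Tags outside \<open>N\<close> are controlled by the derivative; tags in
  \<open>N\<close> get integrand 0 and intervals inside an open set of small measure, where absolute
  continuity bounds the increments.\<close>

theorem abs_cont_on_has_integral:
  assumes f: "abs_cont_on a b f" and ab: "a \<le> b" and N: "negligible N"
    and deriv: "\<And>x. x \<in> {a..b} - N \<Longrightarrow> (f has_real_derivative f' x) (at x within {a..b})"
  shows "(f' has_integral (f b - f a)) {a..b}"
proof -
  define g where "g x = (if x \<in> N then 0 else f' x)" for x
  have "(g has_integral (f b - f a)) {a..b}"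
    unfolding has_integral_real
  proof (intro allI impI)
    fix e :: real
    assume e: "0 < e"
    then have "0 < e / 2" by simp
    then obtain \<delta> where \<delta>: "0 < \<delta>" and ac: "\<forall>I. finite I \<and> (\<forall>i\<in>I. a \<le> fst i \<and> fst i \<le> snd i \<and> snd i \<le> b) \<and>
      pairwise (\<lambda>i j. snd i \<le> fst j \<or> snd j \<le> fst i) I \<and> (\<Sum>i\<in>I. snd i - fst i) < \<delta>
      \<longrightarrow> (\<Sum>i\<in>I. \<bar>f (snd i) - f (fst i)\<bar>) < e / 2"
      by (rule abs_cont_on_separated[OF f])
    obtain T where T: "open T" "N \<subseteq> T" "T - N \<in> lmeasurable" "emeasure lebesgue (T - N) < ennreal \<delta>"
      using sets_lebesgue_outer_open[OF negligible_imp_sets[OF N] \<delta>] by blast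
    have TN: "T = (T - N) \<union> N" using T(2) by blast
    have T_meas: "T \<in> lmeasurable"
      by (subst TN, rule fmeasurable.Un[OF T(3) negligible_imp_measurable[OF N]])
    have "measure lebesgue (T - N) < \<delta>"
      using T(3,4) \<delta> by (simp add: emeasure_eq_measure2 ennreal_less_iff)
    moreover have "measure lebesgue T \<le> measure lebesgue (T - N) + measure lebesgue N"
      by (subst TN, rule measure_Un_le) (use T(3) negligible_imp_sets[OF N] in auto)
    ultimately have mT: "measure lebesgue T < \<delta>" using negligible_imp_measure0[OF N] by simp
    \<comment> \<open>The derivative errors add up to at most \<open>e' * (b - a)\<close>; the
      \<open>+ 1\<close> puts this strictly below \<open>e / 2\<close> and avoids a division by zero
      when \<open>a = b\<close>.\<close>
    define e' where "e' = e / (2 * (b - a + 1))"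
    have e': "0 < e'" using e ab by (simp add: e'_def)
    have "\<exists>d>0. x \<in> {a..b} - N \<longrightarrow>
        (\<forall>y\<in>{a..b}. \<bar>y - x\<bar> < d \<longrightarrow> \<bar>f y - f x - (y - x) * f' x\<bar> \<le> e' * \<bar>y - x\<bar>)" for x
    proof (cases "x \<in> {a..b} - N")
      case True
      then show ?thesis
        using deriv[OF True] e' 
        unfolding has_field_derivative_def has_derivative_within_alt by (auto simp: mult.commute)
    qed (auto intro: exI[of _ 1])
    then obtain d where d: "\<And>x. 0 < d x"
      "\<And>x y. \<lbrakk>x \<in> {a..b} - N; y \<in> {a..b}; \<bar>y - x\<bar> < d x\<rbrakk> \<Longrightarrow> \<bar>f y - f x - (y - x) * f' x\<bar> \<le> e' * \<bar>y - x\<bar>"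
      by metis
    define \<gamma> where "\<gamma> x = (if x \<in> N then T else ball x (d x))" for x
    show "\<exists>\<gamma>. gauge \<gamma> \<and> (\<forall>p. p tagged_division_of {a..b} \<and> \<gamma> fine p \<longrightarrow>
        norm ((\<Sum>(x, k)\<in>p. measure lborel k *\<^sub>R g x) - (f b - f a)) < e)"
    proof (intro exI[of _ \<gamma>] conjI allI impI; (elim conjE)?)
      show "gauge \<gamma>" unfolding gauge_def \<gamma>_def using T d(1) by auto
      fix p
      assume p: "p tagged_division_of {a..b}" and fine: "\<gamma> fine p"
      note fin = tagged_division_of_finite[OF p]
      have el: "\<exists>u v. k = {u..v} \<and> u \<le> x \<and> x \<le> v \<and> a \<le> u \<and> v \<le> b \<and> Inf k = u \<and> Sup k = v"
        if xk: "(x, k) \<in> p" for x k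
      proof -
        obtain u v where uv: "k = cbox u v" using tagged_division_ofD(4)[OF p xk] by blast
        moreover have "x \<in> k" "k \<subseteq> {a..b}" using tagged_division_ofD(2,3)[OF p xk] by auto
        ultimately show ?thesis by (auto intro!: exI[of _ u] exI[of _ v])
      qed
      let ?R = "\<lambda>(x, k). measure lborel k *\<^sub>R g x - (f (Sup k) - f (Inf k))"
      define p1 where "p1 = {(x, k) \<in> p. x \<in> N}"
      \<comment> \<open>Degenerate intervals contribute no increment. Without them any two remaining
        intervals are separated, and the passage to pairs of end points by \<open>h\<close> is
        injective.\<close>
      define p2 where "p2 = {(x, k) \<in> p. x \<in> N \<and> Inf k < Sup k}"
      have p12: "p1 \<subseteq> p" "p2 \<subseteq> p1" "finite p1" "finite p2"
        using fin by (auto simp: p1_def p2_def intro: finite_subset[OF _ fin])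
      have "(\<Sum>(x, k)\<in>p. measure lborel k *\<^sub>R g x) - (f b - f a) = sum ?R p"
        using additive_tagged_division_1[OF ab p, of f]
        by (simp add: case_prod_unfold sum_subtractf)
      also have "sum ?R p = sum ?R p1 + sum ?R (p - p1)"
        using sum.subset_diff[OF p12(1) fin, of ?R] by simp
      finally have split: "(\<Sum>(x, k)\<in>p. measure lborel k *\<^sub>R g x) - (f b - f a) = sum ?R p1 + sum ?R (p - p1)" .
      have "norm (sum ?R (p - p1)) \<le> (\<Sum>(x, k)\<in>p - p1. e' * (Sup k - Inf k))"
      proof (rule sum_norm_le, clarify)
        fix x k assume xk: "(x, k) \<in> p" "(x, k) \<notin> p1"
        then have x: "x \<notin> N" by (simp add: p1_def)
        obtain u v where k: "k = {u..v}" "u \<le> x" "x \<le> v" "a \<le> u" "v \<le> b" "Inf k = u" "Sup k = v"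
          using el[OF xk(1)] by blast
        have "k \<subseteq> ball x (d x)" using fineD[OF fine xk(1)] x by (simp add: \<gamma>_def)
        moreover have "u \<in> k" "v \<in> k" using k by auto
        ultimately have "\<bar>u - x\<bar> < d x" "\<bar>v - x\<bar> < d x" by (auto simp: dist_real_def)
        \<comment> \<open>The tag lies between \<open>u\<close> and \<open>v\<close>, so the two
          errors measured from \<open>x\<close> add up to a multiple of the length
          \<open>v - u\<close>.\<close>
        then have "\<bar>f u - f x - (u - x) * f' x\<bar> \<le> e' * \<bar>u - x\<bar>" "\<bar>f v - f x - (v - x) * f' x\<bar> \<le> e' * \<bar>v - x\<bar>"
          using k x by (intro d(2); simp)+
        moreover have "e' * \<bar>u - x\<bar> + e' * \<bar>v - x\<bar> = e' * (v - u)"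
          using k by (simp add: algebra_simps)
        moreover have "(v - u) * f' x - (f v - f u) =
            (f u - f x - (u - x) * f' x) - (f v - f x - (v - x) * f' x)" by (simp add: algebra_simps)
        ultimately have "\<bar>(v - u) * f' x - (f v - f u)\<bar> \<le> e' * (v - u)" by linarith
        then show "norm (measure lborel k *\<^sub>R g x - (f (Sup k) - f (Inf k))) \<le> e' * (Sup k - Inf k)"
          using k x by (simp add: g_def)
      qed
      also have "\<dots> \<le> (\<Sum>(x, k)\<in>p. e' * (Sup k - Inf k))"
        using e' el fin by (intro sum_mono2) fastforce+
      also have "\<dots> = e' * (b - a)"
        using additive_tagged_division_1[OF ab p, of "\<lambda>x. x"]
        by (simp add: case_prod_unfold sum_distrib_left[symmetric])
      also have "\<dots> < e / 2" using e ab by (simp add: e'_def field_simps)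
      finally have R2: "norm (sum ?R (p - p1)) < e / 2" .
      have sep: "Sup k \<le> Inf l \<or> Sup l \<le> Inf k"
        if "(x, k) \<in> p2" "(y, l) \<in> p2" "(x, k) \<noteq> (y, l)" for x y k l
      proof -
        have xk: "(x, k) \<in> p" "(y, l) \<in> p" "Inf k < Sup k" "Inf l < Sup l"
          using that p12 by (auto simp: p2_def)
        have "interior k \<inter> interior l = {}" using tagged_division_ofD(5)[OF p xk(1,2) that(3)] .
        moreover have "interior k = {Inf k<..<Sup k}" "interior l = {Inf l<..<Sup l}"
          using el[OF xk(1)] el[OF xk(2)] interior_atLeastAtMost_real by metis+
        ultimately have disj: "{Inf k<..<Sup k} \<inter> {Inf l<..<Sup l} = {}" by simp
        show ?thesis
        proof (rule ccontr)
          assume "\<not> (Sup k \<le> Inf l \<or> Sup l \<le> Inf k)"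
          then have "max (Inf k) (Inf l) < min (Sup k) (Sup l)" using xk(3,4) by auto
          then obtain z where "max (Inf k) (Inf l) < z" "z < min (Sup k) (Sup l)" using dense by blast
          then have "z \<in> {Inf k<..<Sup k} \<inter> {Inf l<..<Sup l}" by auto
          then show False using disj by blast
        qed
      qed
      define h where "h = (\<lambda>(x::real, k::real set). (Inf k, Sup k))"
      have inj: "inj_on h p2"
      proof (rule inj_onI)
        fix i j assume "i \<in> p2" "j \<in> p2" "h i = h j"
        then show "i = j" using sep[of "fst i" "snd i" "fst j" "snd j"]
          by (cases i; cases j) (auto simp: h_def p2_def)
      qed
      have pw: "pairwise (\<lambda>i j. snd i \<le> fst j \<or> snd j \<le> fst i) (h ` p2)"
        unfolding pairwise_def using sep by (force simp: h_def)
      have hT: "{fst i..snd i} \<subseteq> T" "a \<le> fst i" "fst i \<le> snd i" "snd i \<le> b" if i: "i \<in> h ` p2" for i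
      proof -
        obtain x k where xk: "(x, k) \<in> p" "x \<in> N" "i = (Inf k, Sup k)"
          using i unfolding h_def p2_def by auto
        have "k \<subseteq> T" using fineD[OF fine xk(1)] xk(2) by (simp add: \<gamma>_def)
        then show "{fst i..snd i} \<subseteq> T" "a \<le> fst i" "fst i \<le> snd i" "snd i \<le> b"
          using el[OF xk(1)] xk(3) by auto
      qed
      have "norm (sum ?R p1) \<le> (\<Sum>(x, k)\<in>p1. \<bar>f (Sup k) - f (Inf k)\<bar>)"
        by (rule sum_norm_le) (auto simp: p1_def g_def)
      also have "\<dots> = (\<Sum>(x, k)\<in>p2. \<bar>f (Sup k) - f (Inf k)\<bar>)"
      proof (rule sum.mono_neutral_right[OF p12(3,2)], clarify)
        fix x k assume xk: "(x, k) \<in> p1" "(x, k) \<notin> p2"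
        then have "\<not> Inf k < Sup k" "(x, k) \<in> p" by (auto simp: p1_def p2_def)
        then have "Inf k = Sup k" using el[of x k] by fastforce
        then show "\<bar>f (Sup k) - f (Inf k)\<bar> = 0" by simp
      qed
      also have "\<dots> = (\<Sum>i\<in>h ` p2. \<bar>f (snd i) - f (fst i)\<bar>)"
        by (subst sum.reindex[OF inj]) (simp add: h_def case_prod_unfold)
      also have "\<dots> < e / 2"
      proof (rule ac[rule_format], intro conjI ballI)
        have "(\<Sum>i\<in>h ` p2. snd i - fst i) = measure lebesgue (\<Union>i\<in>h ` p2. {fst i..snd i})"
          using p12(4) hT(3) pw by (intro measure_Union_separated[symmetric]) auto
        also have "\<dots> \<le> measure lebesgue T"
        proof (rule measure_mono_fmeasurable[OF _ _ T_meas])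
          show "(\<Union>i\<in>h ` p2. {fst i..snd i}) \<subseteq> T" using hT(1) by (rule UN_least)
          show "(\<Union>i\<in>h ` p2. {fst i..snd i}) \<in> sets lebesgue"
            using p12(4) by (intro sets.finite_UN) auto
        qed
        finally show "(\<Sum>i\<in>h ` p2. snd i - fst i) < \<delta>" using mT by simp
      qed (use p12(4) pw hT in auto)
      finally have "norm (sum ?R p1) < e / 2" .
      with R2 show "norm ((\<Sum>(x, k)\<in>p. measure lborel k *\<^sub>R g x) - (f b - f a)) < e"
        unfolding split using norm_triangle_ineq[of "sum ?R p1" "sum ?R (p - p1)"] by linarith
    qed
  qed
  then show ?thesis by (rule has_integral_spike[OF N, rotated]) (simp add: g_def)
qed

subsection \<open>The pendulum equation\<close>

lemma integral_power_0:
  fixes t :: real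
  assumes "0 \<le> t"
  shows "((\<lambda>s. s ^ n) has_integral t ^ Suc n / Suc n) {0..t}"
proof -
  have "((\<lambda>s. s ^ n) has_integral t ^ Suc n / Suc n - 0 ^ Suc n / Suc n) {0..t}"
  proof (intro fundamental_theorem_of_calculus assms)
    fix x
    show "((\<lambda>s. s ^ Suc n / Suc n) has_vector_derivative x ^ n) (at x within {0..t})"
      using DERIV_cdivide[OF DERIV_pow[of "Suc n" x "{0..t}"], of "real (Suc n)"]
      by (simp add: has_real_derivative_iff_has_vector_derivative del: power_Suc)
  qed
  then show ?thesis by simp
qed

text \<open>The absolute value in the force makes every solution nondecreasing, whatever its starting angle;
  the shooting solution stays in \<open>(0, \<pi>/2]\<close>, where it has no effect.\<close>

locale pendulum =
  fixes w :: "real \<Rightarrow> real" and W h :: real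
  assumes h: "0 < h" "h \<le> 1"
    and w_int: "w absolutely_integrable_on {0..h}"
    and w_bd: "\<And>t. t \<in> {0..h} \<Longrightarrow> 0 \<le> w t \<and> w t \<le> W"
begin

definition vel :: "(real \<Rightarrow> real) \<Rightarrow> real \<Rightarrow> real" where
  "vel x s = integral {0..s} (\<lambda>r. w r * \<bar>sin (x r)\<bar>)"

text \<open>A fixed point of \<open>step a\<close> solves \<open>x'' = w * \<bar>sin x\<bar>\<close>
  with \<open>x(0) = a\<close> and \<open>x'(0) = 0\<close>, in the integrated form that a
  discontinuous \<open>w\<close> calls for; \<open>vel x\<close> is then its velocity.\<close>

definition step :: "real \<Rightarrow> (real \<Rightarrow> real) \<Rightarrow> real \<Rightarrow> real" where
  "step a x t = a + integral {0..t} (vel x)"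

lemma W_nonneg: "0 \<le> W" using w_bd[of 0] h by auto

lemma force_absolutely_integrable:
  assumes "continuous_on {0..h} x"
  shows "(\<lambda>r. w r * \<bar>sin (x r)\<bar>) absolutely_integrable_on {0..h}"
proof -
  have c: "continuous_on {0..h} (\<lambda>r. \<bar>sin (x r)\<bar>)" using assms by (intro continuous_intros)
  have "(\<lambda>r. \<bar>sin (x r)\<bar> * w r) absolutely_integrable_on {0..h}"
    using c by (intro absolutely_integrable_bounded_measurable_product_real w_int
      continuous_imp_measurable_on_sets_lebesgue compact_imp_bounded compact_continuous_image) auto
  then show ?thesis by (simp add: mult.commute)
qed

lemma force_integrable:
  assumes "continuous_on {0..h} x" "s \<le> h"
  shows "(\<lambda>r. w r * \<bar>sin (x r)\<bar>) integrable_on {0..s}"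
  using set_lebesgue_integral_eq_integral(1)[OF force_absolutely_integrable[OF assms(1)]]
  by (rule integrable_on_subinterval) (use assms(2) in auto)

lemma vel_continuous:
  assumes "continuous_on {0..h} x"
  shows "continuous_on {0..h} (vel x)"
  unfolding vel_def by (intro indefinite_integral_continuous_1 force_integrable[OF assms]) simp

lemma vel_integrable:
  assumes "continuous_on {0..h} x" "t \<le> h"
  shows "vel x integrable_on {0..t}"
  by (rule integrable_on_subinterval[OF integrable_continuous_real[OF vel_continuous[OF assms(1)]]])
    (use assms(2) in auto)

lemma step_continuous:
  assumes "continuous_on {0..h} x"
  shows "continuous_on {0..h} (step a x)"
  unfolding step_def 
  by (intro continuous_intros indefinite_integral_continuous_1 vel_integrable[OF assms]) simp

lemma abs_sin_diff_le: "\<bar>\<bar>sin x\<bar> - \<bar>sin y\<bar>\<bar> \<le> \<bar>x - y :: real\<bar>"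
proof -
  have "\<bar>sin x - sin y\<bar> \<le> \<bar>x - y\<bar>"
  proof -
    have "sin x - sin y = 2 * sin ((x - y) / 2) * cos ((x + y) / 2)" by (simp add: sin_diff_sin)
    also have "\<bar>\<dots>\<bar> = 2 * \<bar>sin ((x - y) / 2)\<bar> * \<bar>cos ((x + y) / 2)\<bar>" by (simp add: abs_mult)
    also have "\<dots> \<le> 2 * \<bar>(x - y) / 2\<bar> * 1"
      by (intro mult_mono abs_sin_x_le_abs_x) (auto simp: abs_sin_x_le_abs_x)
    finally show ?thesis by simp
  qed
  then show ?thesis using abs_triangle_ineq3[of "sin x" "sin y"] by linarith
qed

lemma vel_nonneg:
  assumes "continuous_on {0..h} x" "s \<in> {0..h}"
  shows "0 \<le> vel x s"
  unfolding vel_def using assms w_bd by (intro integral_nonneg force_integrable) auto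

lemma vel_diff_le:
  assumes x: "continuous_on {0..h} x" and s: "0 \<le> s" "s \<le> t" "t \<le> h"
  shows "\<bar>vel x t - vel x s\<bar> \<le> W * (t - s)"
proof -
  have "integral {0..s} (\<lambda>r. w r * \<bar>sin (x r)\<bar>) + integral {s..t} (\<lambda>r. w r * \<bar>sin (x r)\<bar>) = vel x t"
    unfolding vel_def using s by (intro Henstock_Kurzweil_Integration.integral_combine force_integrable[OF x]) auto
  moreover have "norm (integral {s..t} (\<lambda>r. w r * \<bar>sin (x r)\<bar>)) \<le> W * (t - s)"
  proof -
    have "norm (integral {s..t} (\<lambda>r. w r * \<bar>sin (x r)\<bar>)) \<le> integral {s..t} (\<lambda>r. W)"
    proof (rule integral_norm_bound_integral)
      show "(\<lambda>r. w r * \<bar>sin (x r)\<bar>) integrable_on {s..t}"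
        by (rule integrable_on_subinterval[OF force_integrable[OF x s(3)]]) (use s in auto)
      show "norm (w r * \<bar>sin (x r)\<bar>) \<le> W" if "r \<in> {s..t}" for r
        using mult_mono[of "w r" W "\<bar>sin (x r)\<bar>" 1] w_bd[of r] that s by (auto simp: abs_mult)
    qed auto
    then show ?thesis using s by (simp add: mult.commute)
  qed
  ultimately show ?thesis unfolding vel_def by (simp add: real_norm_def)
qed

text \<open>The inner integration is estimated crudely, its factor \<open>s \<le> h \<le> 1\<close>
  being dropped; the outer one turns \<open>r ^ n\<close> into \<open>t ^ (n + 1) / (n + 1)\<close>,
  and this one power per step already yields factorials. With \<open>a = b\<close> it compares
  iterates; with \<open>n = 0\<close> it gives Lipschitz dependence on the starting angle and the
  passage to the limit.\<close>

lemma step_diff_le: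
  assumes x: "continuous_on {0..h} x" and y: "continuous_on {0..h} y" 
    and le: "\<And>r. r \<in> {0..h} \<Longrightarrow> \<bar>x r - y r\<bar> \<le> C * r ^ n" and t: "t \<in> {0..h}"
  shows "\<bar>step a x t - step b y t\<bar> \<le> \<bar>a - b\<bar> + W * C * (t ^ Suc n / Suc n)"
proof -
  have "0 \<le> C * h ^ n" using le[of h] h by (force intro: order_trans[OF abs_ge_zero])
  then have C: "0 \<le> C" using zero_less_power[OF h(1), of n] by (auto simp: zero_le_mult_iff)
  have V: "\<bar>vel x s - vel y s\<bar> \<le> W * C * s ^ n" if s: "s \<in> {0..t}" for s
  proof -
    have sh: "0 \<le> s" "s \<le> h" using s t by auto
    have "vel x s - vel y s = integral {0..s} (\<lambda>r. w r * \<bar>sin (x r)\<bar> - w r * \<bar>sin (y r)\<bar>)"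
      unfolding vel_def using sh
      by (intro Henstock_Kurzweil_Integration.integral_diff[symmetric] force_integrable x y) auto
    also have "norm \<dots> \<le> integral {0..s} (\<lambda>r. W * (C * s ^ n))"
    proof (rule integral_norm_bound_integral)
      show "(\<lambda>r. w r * \<bar>sin (x r)\<bar> - w r * \<bar>sin (y r)\<bar>) integrable_on {0..s}"
        using sh by (intro Henstock_Kurzweil_Integration.integrable_diff force_integrable x y) auto
      fix r assume r: "r \<in> {0..s}"
      then have rh: "r \<in> {0..h}" using sh by auto
      have "\<bar>\<bar>sin (x r)\<bar> - \<bar>sin (y r)\<bar>\<bar> \<le> C * r ^ n"
        using abs_sin_diff_le le[OF rh] by (rule order_trans)
      also have "\<dots> \<le> C * s ^ n" using r C by (intro mult_left_mono power_mono) auto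
      finally have "\<bar>\<bar>sin (x r)\<bar> - \<bar>sin (y r)\<bar>\<bar> \<le> C * s ^ n" .
      then have "\<bar>w r\<bar> * \<bar>\<bar>sin (x r)\<bar> - \<bar>sin (y r)\<bar>\<bar> \<le> W * (C * s ^ n)"
        using w_bd[OF rh] by (intro mult_mono) auto
      then show "norm (w r * \<bar>sin (x r)\<bar> - w r * \<bar>sin (y r)\<bar>) \<le> W * (C * s ^ n)"
        by (simp add: abs_mult[symmetric] right_diff_distrib)
    qed auto
    also have "\<dots> = (W * C * s ^ n) * s" using sh by simp
    also have "\<dots> \<le> (W * C * s ^ n) * 1"
      using sh h W_nonneg C by (intro mult_left_mono) auto
    finally show ?thesis by simp
  qed
  have hi: "((\<lambda>s. W * C * s ^ n) has_integral W * C * (t ^ Suc n / Suc n)) {0..t}"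
    using integral_power_0 t by (intro has_integral_mult_right) auto
  have "step a x t - step b y t = (a - b) + integral {0..t} (\<lambda>s. vel x s - vel y s)"
    unfolding step_def using t
    by (subst Henstock_Kurzweil_Integration.integral_diff) (auto intro!: vel_integrable x y)
  moreover have "norm (integral {0..t} (\<lambda>s. vel x s - vel y s)) \<le> integral {0..t} (\<lambda>s. W * C * s ^ n)"
    using t V by (intro integral_norm_bound_integral Henstock_Kurzweil_Integration.integrable_diff
      vel_integrable x y has_integral_integrable[OF hi]) auto
  ultimately show ?thesis
    unfolding integral_unique[OF hi] by (simp add: real_norm_def)
qed

primrec picard :: "real \<Rightarrow> nat \<Rightarrow> real \<Rightarrow> real" where
  "picard a 0 = (\<lambda>t. a)"
| "picard a (Suc n) = step a (picard a n)"

lemma picard_continuous: "continuous_on {0..h} (picard a n)"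
  by (induction n) (auto intro: step_continuous)

text \<open>The base case integrates a force of size at most \<open>W\<close> twice over a length of
  at most 1; afterwards each application of \<open>step\<close> contributes a factor
  \<open>W * t / (n + 1)\<close>.\<close>

lemma picard_diff_le:
  assumes "t \<in> {0..h}"
  shows "\<bar>picard a (Suc n) t - picard a n t\<bar> \<le> W * W ^ n / fact n * t ^ n"
  using assms
proof (induction n arbitrary: t)
  case 0
  have "vel (\<lambda>t. a) 0 = 0" by (simp add: vel_def)
  then have V: "\<bar>vel (\<lambda>t. a) s\<bar> \<le> W" if "s \<in> {0..t}" for s
    using vel_diff_le[of "\<lambda>t. a" 0 s] that 0 h W_nonneg mult_left_mono[of s 1 W] by force
  have "norm (integral {0..t} (vel (\<lambda>t. a))) \<le> integral {0..t} (\<lambda>s. W)"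
    using V 0 by (intro integral_norm_bound_integral vel_integrable) auto
  also have "\<dots> \<le> W" using 0 h W_nonneg mult_left_mono[of t 1 W] by (simp add: mult.commute)
  finally show ?case by (simp add: step_def)
next
  case (Suc n)
  have "\<bar>picard a (Suc (Suc n)) t - picard a (Suc n) t\<bar> =
      \<bar>step a (picard a (Suc n)) t - step a (picard a n) t\<bar>" by simp
  also have "\<dots> \<le> \<bar>a - a\<bar> + W * (W * W ^ n / fact n) * (t ^ Suc n / Suc n)"
    by (rule step_diff_le[OF picard_continuous picard_continuous Suc.IH Suc.prems])
  also have "\<dots> = W * W ^ Suc n / fact (Suc n) * t ^ Suc n"
    by (simp add: field_simps)
  finally show ?case .
qed

text \<open>The constant grows with \<open>n\<close>, but it serves only to make each iterate
  continuous in the starting angle; the limit inherits continuity by uniform convergence.\<close>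

lemma picard_lipschitz:
  assumes "t \<in> {0..h}"
  shows "\<bar>picard a n t - picard b n t\<bar> \<le> (1 + W) ^ n * \<bar>a - b\<bar>"
  using assms
proof (induction n arbitrary: t)
  case (Suc n)
  have le: "\<bar>picard a n r - picard b n r\<bar> \<le> (1 + W) ^ n * \<bar>a - b\<bar> * r ^ 0" if "r \<in> {0..h}" for r
    using Suc.IH[OF that] by simp
  have nn: "0 \<le> W * ((1 + W) ^ n * \<bar>a - b\<bar>)" using W_nonneg by simp
  have "\<bar>picard a (Suc n) t - picard b (Suc n) t\<bar> \<le> \<bar>a - b\<bar> + W * ((1 + W) ^ n * \<bar>a - b\<bar>) * (t ^ Suc 0 / Suc 0)"
    using step_diff_le[OF picard_continuous picard_continuous le Suc.prems] by simp
  also have "\<dots> \<le> (1 + W) ^ n * \<bar>a - b\<bar> + W * ((1 + W) ^ n * \<bar>a - b\<bar>) * 1"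
  proof (rule add_mono)
    show "\<bar>a - b\<bar> \<le> (1 + W) ^ n * \<bar>a - b\<bar>"
      using mult_right_mono[of 1 "(1 + W) ^ n" "\<bar>a - b\<bar>"] W_nonneg by (simp add: one_le_power)
    show "W * ((1 + W) ^ n * \<bar>a - b\<bar>) * (t ^ Suc 0 / Suc 0) \<le> W * ((1 + W) ^ n * \<bar>a - b\<bar>) * 1"
      using nn Suc.prems h by (intro mult_left_mono) auto
  qed
  also have "\<dots> = (1 + W) ^ Suc n * \<bar>a - b\<bar>" by (simp add: algebra_simps)
  finally show ?case .
qed simp

text \<open>The sine is bounded, so the estimate of consecutive iterates does not involve
  \<open>a\<close>, and convergence is uniform in the starting angle over the whole line as well as
  in time.\<close>

lemma picard_uniform_limit:
  obtains x where "uniform_limit (UNIV \<times> {0..h}) (\<lambda>n (a, t). picard a n t) x sequentially"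
proof -
  let ?f = "\<lambda>n (a, t). picard a (Suc n) t - picard a n t"
  have "summable (\<lambda>n. W * (W ^ n / fact n))"
    using summable_exp[of W] by (intro summable_mult) (simp add: field_simps)
  moreover have "norm (?f n p) \<le> W * (W ^ n / fact n)" if "p \<in> UNIV \<times> {0..h}" for n p
  proof -
    obtain a t where p: "p = (a, t)" "t \<in> {0..h}" using \<open>p \<in> _\<close> by auto
    have "\<bar>picard a (Suc n) t - picard a n t\<bar> \<le> W * W ^ n / fact n * t ^ n"
      using picard_diff_le[OF p(2)] .
    also have "\<dots> \<le> W * W ^ n / fact n * 1"
      using p(2) h W_nonneg by (intro mult_left_mono power_le_one) auto
    finally show ?thesis using p by simp
  qed
  ultimately have "uniform_limit (UNIV \<times> {0..h}) (\<lambda>n p. \<Sum>i<n. ?f i p) (\<lambda>p. suminf (\<lambda>i. ?f i p)) sequentially"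
    by (intro Weierstrass_m_test) auto
  then have "uniform_limit (UNIV \<times> {0..h}) (\<lambda>n p. fst p + (\<Sum>i<n. ?f i p))
      (\<lambda>p. fst p + suminf (\<lambda>i. ?f i p)) sequentially"
    by (intro uniform_limit_add uniform_limit_const)
  moreover have "fst p + (\<Sum>i<n. ?f i p) = (case p of (a, t) \<Rightarrow> picard a n t)" for n p
    using sum_lessThan_telescope[of "\<lambda>i. picard (fst p) i (snd p)" n]
    by (simp add: case_prod_unfold del: picard.simps(2))
  ultimately show thesis using that by simp
qed

text \<open>The final angle depends continuously on \<open>a\<close>. It is 0 for
  \<open>a = 0\<close>, where the pendulum rests in equilibrium, and at least \<open>pi / 2\<close>
  for \<open>a = pi / 2\<close>, because solutions do not decrease; the intermediate value theorem
  finds the start in between.\<close>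

theorem shooting:
  assumes w_pos: "\<And>t. t \<in> {0..<h} \<Longrightarrow> 0 < w t"
  obtains a x where "0 < a" "continuous_on {0..h} x" "x h = pi / 2"
    "\<And>t. t \<in> {0..h} \<Longrightarrow> x t = a + integral {0..t} (vel x)"
proof -
  obtain X where X: "uniform_limit (UNIV \<times> {0..h}) (\<lambda>n (a, t). picard a n t) X sequentially"
    by (rule picard_uniform_limit)
  define x where "x a t = X (a, t)" for a t
  have close: "eventually (\<lambda>n. \<forall>a. \<forall>t\<in>{0..h}. \<bar>picard a n t - x a t\<bar> < e) sequentially" if "0 < e" for e
    using uniform_limitD[OF X that] by eventually_elim (auto simp: x_def dist_real_def)
  have lim: "(\<lambda>n. picard a n t) \<longlonglongrightarrow> x a t" if t: "t \<in> {0..h}" for a t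
  proof (rule tendstoI)
    fix e :: real assume "0 < e"
    from close[OF this] show "\<forall>\<^sub>F n in sequentially. dist (picard a n t) (x a t) < e"
      by eventually_elim (use t in \<open>auto simp: dist_real_def\<close>)
  qed
  have cont: "continuous_on {0..h} (x a)" for a
  proof (rule uniform_limit_theorem)
    show "uniform_limit {0..h} (picard a) (x a) sequentially"
    proof (rule uniform_limitI)
      fix e :: real assume "0 < e"
      from close[OF this] show "\<forall>\<^sub>F n in sequentially. \<forall>t\<in>{0..h}. dist (picard a n t) (x a t) < e"
        by eventually_elim (auto simp: dist_real_def)
    qed
  qed (auto simp: picard_continuous)
  have fix_eq: "x a t = step a (x a) t" if t: "t \<in> {0..h}" for a t
  proof (rule LIMSEQ_unique)
    show "(\<lambda>n. picard a (Suc n) t) \<longlonglongrightarrow> x a t" using lim[OF t] by (rule LIMSEQ_Suc)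
    show "(\<lambda>n. picard a (Suc n) t) \<longlonglongrightarrow> step a (x a) t"
    proof (rule tendstoI)
      fix e :: real assume e: "0 < e"
      \<comment> \<open>In the supremum norm \<open>step\<close> has Lipschitz constant at most
        \<open>W\<close>, so an error \<open>d\<close> in the iterate becomes at most
        \<open>W * d < e\<close>.\<close>
      define d where "d = e / (W + 1)"
      have "0 < d" using e W_nonneg by (simp add: d_def)
      from close[OF this] show "\<forall>\<^sub>F n in sequentially. dist (picard a (Suc n) t) (step a (x a) t) < e"
      proof eventually_elim
        case (elim n)
        have le: "\<bar>picard a n r - x a r\<bar> \<le> d * r ^ 0" if "r \<in> {0..h}" for r
          using elim that by (auto simp: less_imp_le)
        have "\<bar>step a (picard a n) t - step a (x a) t\<bar> \<le> \<bar>a - a\<bar> + W * d * (t ^ Suc 0 / Suc 0)"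
          by (rule step_diff_le[OF picard_continuous cont le t])
        also have "\<dots> \<le> W * d * 1" using t h W_nonneg \<open>0 < d\<close> by (simp add: mult_left_le)
        also have "\<dots> < (W + 1) * d" using \<open>0 < d\<close> by simp
        also have "\<dots> = e" using W_nonneg by (simp add: d_def)
        finally show ?case by (simp add: dist_real_def)
      qed
    qed
  qed
  have cont_a: "continuous_on UNIV (\<lambda>a. x a h)"
  proof (rule uniform_limit_theorem)
    show "uniform_limit UNIV (\<lambda>n a. picard a n h) (\<lambda>a. x a h) sequentially"
    proof (rule uniform_limitI)
      fix e :: real assume "0 < e"
      from close[OF this] show "\<forall>\<^sub>F n in sequentially. \<forall>a\<in>UNIV. dist (picard a n h) (x a h) < e"
        by eventually_elim (use h in \<open>auto simp: dist_real_def\<close>)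
    qed
    have "continuous_on UNIV (\<lambda>a. picard a n h)" for n
    proof (rule lipschitz_on_continuous_on)
      show "lipschitz_on ((1 + W) ^ n) UNIV (\<lambda>a. picard a n h)"
        using picard_lipschitz[of h _ n] h W_nonneg by (intro lipschitz_onI) (auto simp: dist_real_def)
    qed
    then show "\<forall>\<^sub>F n in sequentially. continuous_on UNIV (\<lambda>a. picard a n h)" by simp
  qed auto
  have ge: "a \<le> x a t" if "t \<in> {0..h}" for a t
    unfolding fix_eq[OF that] step_def using that
    by (auto intro!: integral_nonneg vel_integrable cont vel_nonneg)
  have "picard 0 n t = 0" if "t \<in> {0..h}" for n t
    using that
  proof (induction n arbitrary: t)
    case (Suc n)
    have "vel (picard 0 n) s = 0" if "s \<in> {0..t}" for s
    proof -
      have "vel (picard 0 n) s = integral {0..s} (\<lambda>r. 0)"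
        unfolding vel_def using Suc that by (intro integral_cong) auto
      then show ?thesis by simp
    qed
    then have "integral {0..t} (vel (picard 0 n)) = integral {0..t} (\<lambda>r. 0)"
      by (intro integral_cong) auto
    then show ?case by (simp add: step_def)
  qed simp
  then have x0: "x 0 t = 0" if "t \<in> {0..h}" for t
    using lim[OF that, of 0] that by (simp add: LIMSEQ_const_iff)
  have "\<exists>a. 0 \<le> a \<and> a \<le> pi / 2 \<and> x a h = pi / 2"
    using ge[of h "pi / 2"] x0[of h] h continuous_on_subset[OF cont_a]
    by (intro IVT') auto
  then obtain a where a: "0 \<le> a" "x a h = pi / 2" by blast
  have "a \<noteq> 0" using a(2) x0[of h] h by auto
  then show thesis
    using that[of a "x a"] a cont fix_eq unfolding step_def by auto
qed

end

section \<open>One-sided derivatives of integrals, positivity, and reflection about 1/2\<close>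

lemma integral_has_derivative_at_right:
  fixes f :: "real \<Rightarrow> real"
  assumes f: "f integrable_on {a..b}" and t: "a \<le> t" "t < b" and R: "(f \<longlongrightarrow> R) (at_right t)"
  shows "((\<lambda>s. integral {a..s} f) has_real_derivative R) (at_right t)"
proof -
  \<comment> \<open>Only a one-sided limit of \<open>f\<close> is available. Giving the integrand
    this limit as its value at \<open>t\<close> makes it continuous from the right there and leaves
    all integrals unchanged.\<close>
  define g where "g = f(t := R)"
  have int: "f integrable_on {c..d}" if "a \<le> c" "d \<le> b" for c d
    by (rule integrable_on_subinterval[OF f]) (use that in auto)
  have g: "g integrable_on {t..b}"
    using int[OF t(1) order_refl] by (rule integrable_spike_finite[of "{t}", rotated 2]) (auto simp: g_def)
  have eq: "integral {t..s} g = integral {t..s} f" for s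
    by (rule integral_spike[of "{t}"]) (auto simp: g_def)
  have "(g \<longlongrightarrow> R) (at_right t)"
    using R by (rule Lim_transform_eventually) (auto simp: eventually_at_filter g_def)
  then have "continuous (at t within {t..b}) g"
    unfolding continuous_within by (simp add: at_within_Icc_at_right[OF t(2)] g_def)
  then have "((\<lambda>s. integral {t..s} g) has_vector_derivative g t) (at t within {t..b})"
    using integral_has_vector_derivative_continuous_at[OF g, of t "{}"] t by simp
  then have *: "((\<lambda>s. integral {a..t} f + integral {t..s} f) has_real_derivative R) (at_right t)"
    using DERIV_add[OF DERIV_const, of "\<lambda>s. integral {t..s} g" R t "{t<..}"] eq
    by (simp add: has_real_derivative_iff_has_vector_derivative at_within_Icc_at_right[OF t(2)] g_def)
  have comb: "integral {a..s} f = integral {a..t} f + integral {t..s} f" if "t \<le> s" "s \<le> b" for s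
    using Henstock_Kurzweil_Integration.integral_combine[OF t(1) that(1) int[OF order_refl that(2)]] by simp
  have "\<forall>\<^sub>F s in at_right t. integral {a..s} f = integral {a..t} f + integral {t..s} f"
    unfolding eventually_at_right[OF t(2)]
  proof (intro exI[of _ b] conjI allI impI t(2))
    fix s assume "t < s" "s < b"
    then show "integral {a..s} f = integral {a..t} f + integral {t..s} f" by (intro comb less_imp_le)
  qed
  from has_field_derivative_cong_eventually[OF this comb[OF order_refl less_imp_le[OF t(2)]]]
  show ?thesis using * by (rule iffD2)
qed

lemma integral_has_derivative_at_left:
  fixes f :: "real \<Rightarrow> real"
  assumes f: "f integrable_on {a..b}" and t: "a < t" "t \<le> b" and R: "(f \<longlongrightarrow> R) (at_left t)"
  shows "((\<lambda>s. integral {a..s} f) has_real_derivative R) (at_left t)"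
proof -
  define g where "g = f(t := R)"
  have "f integrable_on {a..t}"
    by (rule integrable_on_subinterval[OF f]) (use t in auto)
  then have g: "g integrable_on {a..t}"
    by (rule integrable_spike_finite[of "{t}", rotated 2]) (auto simp: g_def)
  have eq: "integral {a..s} g = integral {a..s} f" for s
    by (rule integral_spike[of "{t}"]) (auto simp: g_def)
  have "(g \<longlongrightarrow> R) (at_left t)"
    using R by (rule Lim_transform_eventually) (auto simp: eventually_at_filter g_def)
  then have "continuous (at t within {a..t}) g"
    unfolding continuous_within by (simp add: at_within_Icc_at_left[OF t(1)] g_def)
  then have "((\<lambda>s. integral {a..s} g) has_vector_derivative g t) (at t within {a..t})"
    using integral_has_vector_derivative_continuous_at[OF g, of t "{}"] t by simp
  then show ?thesis
    by (simp add: eq has_real_derivative_iff_has_vector_derivative at_within_Icc_at_left[OF t(1)])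
      (simp add: g_def)
qed

text \<open>A nonnegative function with integral 0 vanishes almost everywhere, yet a nonempty open
  interval is not negligible. The argument suits a force that contains the possibly discontinuous
  payoff.\<close>

lemma integral_pos_interval:
  fixes f :: "real \<Rightarrow> real"
  assumes f: "f absolutely_integrable_on {a..b}" and ab: "a < b"
    and nonneg: "\<And>x. x \<in> {a..b} \<Longrightarrow> 0 \<le> f x" and pos: "\<And>x. x \<in> {a<..<b} \<Longrightarrow> 0 < f x"
  shows "0 < integral {a..b} f"
proof (rule ccontr)
  assume "\<not> 0 < integral {a..b} f"
  moreover have "0 \<le> integral {a..b} f"
    using nonneg by (intro integral_nonneg set_lebesgue_integral_eq_integral(1)[OF f]) auto
  ultimately have 0: "integral {a..b} f = 0" by simp
  let ?f = "\<lambda>x. indicator {a..b} x *\<^sub>R f x"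
  have int: "integrable lebesgue ?f" using f unfolding set_integrable_def .
  have "(LINT x|lebesgue. ?f x) = 0"
    using set_lebesgue_integral_eq_integral(2)[OF f] 0 unfolding set_lebesgue_integral_def by simp
  moreover have "AE x in lebesgue. 0 \<le> ?f x" using nonneg by (auto simp: indicator_def)
  ultimately have "AE x in lebesgue. ?f x = 0"
    using integral_nonneg_eq_0_iff_AE[OF int] by simp
  then have "AE x in lebesgue. x \<notin> {a<..<b}"
    by eventually_elim (use pos in \<open>force simp: indicator_def\<close>)
  then have "negligible {a<..<b}"
    by (simp add: negligible_iff_null_sets AE_iff_null_sets)
  then show False using open_not_negligible[of "{a<..<b}"] ab by auto
qed

lemma has_derivative_reflect_left:
  fixes f :: "real \<Rightarrow> real"
  assumes "(f has_real_derivative D) (at_right (1 - t))"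
  shows "((\<lambda>s. f (1 - s)) has_real_derivative - D) (at_left t)"
proof -
  have im: "(\<lambda>s. 1 - s) ` {..<t} = {1 - t<..}"
    by (auto intro!: image_eqI[of _ _ "1 - _"])
  have "((\<lambda>s. 1 - s) has_real_derivative - 1) (at_left t)"
    by (auto intro!: derivative_eq_intros)
  from DERIV_image_chain[OF _ this, of f D] show ?thesis
    using assms unfolding im comp_def by simp
qed

lemma has_derivative_reflect_right:
  fixes f :: "real \<Rightarrow> real"
  assumes "(f has_real_derivative D) (at_left (1 - t))"
  shows "((\<lambda>s. f (1 - s)) has_real_derivative - D) (at_right t)"
proof -
  have im: "(\<lambda>s. 1 - s) ` {t<..} = {..<1 - t}"
    by (auto intro!: image_eqI[of _ _ "1 - _"])
  have "((\<lambda>s. 1 - s) has_real_derivative - 1) (at_right t)"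
    by (auto intro!: derivative_eq_intros)
  from DERIV_image_chain[OF _ this, of f D] show ?thesis
    using assms unfolding im comp_def by simp
qed

lemma filterlim_reflect_left: "filterlim (\<lambda>s. 1 - s) (at_right (1 - t)) (at_left (t::real))"
  unfolding filterlim_at
proof
  show "((\<lambda>s. 1 - s) \<longlongrightarrow> 1 - t) (at_left t)" by (intro tendsto_intros)
qed (auto simp: eventually_at_filter)

lemma filterlim_reflect_right: "filterlim (\<lambda>s. 1 - s) (at_left (1 - t)) (at_right (t::real))"
  unfolding filterlim_at
proof
  show "((\<lambda>s. 1 - s) \<longlongrightarrow> 1 - t) (at_right t)" by (intro tendsto_intros)
qed (auto simp: eventually_at_filter)

section \<open>Regularity of piecewise continuous payoffs\<close>

lemma partition_locate:
  fixes \<tau> :: "nat \<Rightarrow> real"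
  shows "\<tau> 0 \<le> t \<Longrightarrow> t < \<tau> N \<Longrightarrow> \<exists>i<N. \<tau> i \<le> t \<and> t < \<tau> (Suc i)"
    and "\<tau> 0 < t \<Longrightarrow> t \<le> \<tau> N \<Longrightarrow> \<exists>i<N. \<tau> i < t \<and> t \<le> \<tau> (Suc i)"
proof (induction N)
  case (Suc N)
  { case 1 show ?case using Suc(1) 1 by (cases "t < \<tau> N") (auto simp: less_Suc_eq) }
  { case 2 show ?case using Suc(2) 2 by (cases "t \<le> \<tau> N") (auto simp: less_Suc_eq) }
qed auto

lemma piecewise_continuous_limits:
  assumes "piecewise_continuous u"
  shows "t \<in> {0..<1} \<Longrightarrow> \<exists>R. (u \<longlongrightarrow> R) (at_right t)"
    and "t \<in> {0<..1} \<Longrightarrow> \<exists>R. (u \<longlongrightarrow> R) (at_left t)"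
    and "\<exists>S. finite S \<and> (\<forall>t\<in>{0..1} - S. isCont u t)"
    and "\<exists>B. \<forall>t\<in>{0..1}. \<bar>u t\<bar> \<le> B"
    and "u integrable_on {0..1}"
proof -
  obtain N \<tau> where \<tau>: "\<tau> 0 = 0" "\<tau> N = 1" and
    pc: "\<And>i. i < N \<Longrightarrow> \<tau> i < \<tau> (Suc i) \<and> continuous_on {\<tau> i<..<\<tau> (Suc i)} u \<and>
        (\<exists>r. (u \<longlongrightarrow> r) (at_right (\<tau> i))) \<and> (\<exists>l. (u \<longlongrightarrow> l) (at_left (\<tau> (Suc i))))"
    using assms unfolding piecewise_continuous_def by blast
  have cont: "isCont u t" if "i < N" "\<tau> i < t" "t < \<tau> (Suc i)" for i t
    using continuous_on_eq_continuous_at[of "{\<tau> i<..<\<tau> (Suc i)}" u] pc[OF that(1)] that by auto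
  show "\<exists>R. (u \<longlongrightarrow> R) (at_right t)" if t: "t \<in> {0..<1}"
  proof -
    obtain i where i: "i < N" "\<tau> i \<le> t" "t < \<tau> (Suc i)"
      using partition_locate(1)[of \<tau> t N] t \<tau> by auto
    show ?thesis
    proof (cases "\<tau> i = t")
      case False
      then have "(u \<longlongrightarrow> u t) (at t)" using cont[of i t] i by (simp add: isCont_def)
      then show ?thesis using filterlim_at_split by blast
    qed (use pc[OF i(1)] in auto)
  qed
  show "\<exists>R. (u \<longlongrightarrow> R) (at_left t)" if t: "t \<in> {0<..1}"
  proof -
    obtain i where i: "i < N" "\<tau> i < t" "t \<le> \<tau> (Suc i)"
      using partition_locate(2)[of \<tau> t N] t \<tau> by auto
    show ?thesis
    proof (cases "\<tau> (Suc i) = t")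
      case False
      then have "(u \<longlongrightarrow> u t) (at t)" using cont[of i t] i by (simp add: isCont_def)
      then show ?thesis using filterlim_at_split by blast
    qed (use pc[OF i(1)] in auto)
  qed
  show "\<exists>S. finite S \<and> (\<forall>t\<in>{0..1} - S. isCont u t)"
  proof (intro exI[of _ "\<tau> ` {..N}"] conjI ballI)
    fix t assume t: "t \<in> {0..1} - \<tau> ` {..N}"
    then have "t \<noteq> \<tau> 0" "t \<noteq> \<tau> N" by auto
    then obtain i where i: "i < N" "\<tau> i \<le> t" "t < \<tau> (Suc i)"
      using partition_locate(1)[of \<tau> t N] t \<tau> by auto
    moreover have "t \<noteq> \<tau> i" using t i(1) by auto
    ultimately show "isCont u t" using cont by force
  qed simp
  have "0 \<le> \<tau> n \<and> (\<exists>B. \<forall>t\<in>{0..\<tau> n}. \<bar>u t\<bar> \<le> B) \<and> u integrable_on {0..\<tau> n}" if "n \<le> N" for n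
    using that
  proof (induction n)
    case 0
    then show ?case using integrable_on_refl[of u "0::real"] by (auto simp: \<tau>)
  next
    case (Suc n)
    then obtain B where B: "0 \<le> \<tau> n" "\<forall>t\<in>{0..\<tau> n}. \<bar>u t\<bar> \<le> B" "u integrable_on {0..\<tau> n}" by auto
    let ?a = "\<tau> n" and ?b = "\<tau> (Suc n)"
    have n: "n < N" using Suc.prems by simp
    obtain r l where lim: "(u \<longlongrightarrow> r) (at_right ?a)" "(u \<longlongrightarrow> l) (at_left ?b)" and ab: "?a < ?b"
      using pc[OF n] by blast
    \<comment> \<open>With the one-sided limits as end values the function is continuous on the
      closed piece, hence bounded and integrable; on the piece \<open>u\<close> can differ from it
      only at the two ends.\<close>
    define g where "g x = (if x \<le> ?a then r else if x \<ge> ?b then l else u x)" for x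
    have ga: "g ?a = r" and gb: "g ?b = l" using ab by (auto simp: g_def)
    have gx: "g x = u x" if "?a < x" "x < ?b" for x using that by (simp add: g_def)
    have "continuous_on {?a..?b} g"
    proof (rule continuous_on_IccI[OF _ _ _ ab])
      have "\<forall>\<^sub>F x in at_right ?a. u x = g x"
        unfolding eventually_at_right[OF ab] using ab by (intro exI[of _ ?b]) (auto simp: g_def)
      from Lim_transform_eventually[OF lim(1) this] show "(g \<longlongrightarrow> g ?a) (at_right ?a)" by (simp add: ga)
      have "\<forall>\<^sub>F x in at_left ?b. u x = g x"
        unfolding eventually_at_left[OF ab] using ab by (intro exI[of _ ?a]) (auto simp: g_def)
      from Lim_transform_eventually[OF lim(2) this] show "(g \<longlongrightarrow> g ?b) (at_left ?b)" by (simp add: gb)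
      fix x assume x: "?a < x" "x < ?b"
      have "\<forall>\<^sub>F y in at x. u y = g y"
        unfolding eventually_at_topological using x
        by (intro exI[of _ "{?a<..<?b}"]) (auto simp: g_def)
      from Lim_transform_eventually[OF _ this] show "g \<midarrow>x\<rightarrow> g x"
        using cont[OF n x] gx[OF x] by (simp add: isCont_def)
    qed
    then have g: "compact (g ` {?a..?b})" "g integrable_on {?a..?b}"
      by (auto intro: compact_continuous_image integrable_continuous_real)
    then obtain C where C: "\<forall>t\<in>{?a..?b}. \<bar>g t\<bar> \<le> C"
      using compact_imp_bounded[of "g ` {?a..?b}"] by (auto simp: bounded_iff)
    have "u integrable_on {?a..?b}"
      using g(2) by (rule integrable_spike_finite[of "{?a, ?b}", rotated 2]) (auto simp: g_def)
    \<comment> \<open>The value of \<open>u\<close> at a partition point is unrelated to its limits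
      there and enters the bound separately; the value at \<open>?a\<close> is covered by
      \<open>B\<close>.\<close>
    moreover have "\<bar>u t\<bar> \<le> max (max B C) \<bar>u ?b\<bar>" if t: "t \<in> {0..?b}" for t
    proof -
      consider "t \<in> {0..?a}" | "?a < t" "t < ?b" | "t = ?b"
        using t by force
      then show ?thesis
      proof cases
        case 2
        then have "\<bar>g t\<bar> \<le> C" using C by auto
        then show ?thesis using 2 by (simp add: gx le_max_iff_disj)
      qed (use B in \<open>auto simp: le_max_iff_disj\<close>)
    qed
    ultimately show ?case
      using B(1,3) ab by (intro conjI exI[of _ "max (max B C) \<bar>u ?b\<bar>"])
        (auto intro: Henstock_Kurzweil_Integration.integrable_combine[of 0 ?a ?b])
  qed
  from this[of N] show "\<exists>B. \<forall>t\<in>{0..1}. \<bar>u t\<bar> \<le> B" "u integrable_on {0..1}" by (auto simp: \<tau>)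
qed

text \<open>The equation is recorded through one-sided derivatives of \<open>v\<close>, which has a
  corner wherever the one-sided limits of \<open>u\<close> differ. The Lipschitz bound on
  \<open>v\<close> later makes the costate Lipschitz.\<close>

theorem stationary_angle:
  assumes pc: "piecewise_continuous u"
    and antisym: "\<forall>t\<in>{0..1}. u t = - u (1 - t)"
    and neg: "\<forall>t\<in>{0..<1/2}. u t < 0"
  obtains \<theta> v :: "real \<Rightarrow> real" and W :: real where
    "0 \<le> W" "0 < \<theta> 0" "\<theta> (1/2) = pi / 2" "v 0 = 0" "v 1 = 0"
    "\<forall>t\<in>{0..1}. (\<theta> has_real_derivative v t) (at t within {0..1})"
    "\<forall>t\<in>{0..1}. \<theta> t + \<theta> (1 - t) = pi"
    "\<forall>t\<in>{0<..<1}. 0 < v t"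
    "\<forall>s\<in>{0..1}. \<forall>t\<in>{0..1}. \<bar>v t - v s\<bar> \<le> W * \<bar>t - s\<bar>"
    "\<forall>t\<in>{0..<1}. \<forall>R. (u \<longlongrightarrow> R) (at_right t) \<longrightarrow> (v has_real_derivative - R / 4 * sin (\<theta> t)) (at_right t)"
    "\<forall>t\<in>{0<..1}. \<forall>R. (u \<longlongrightarrow> R) (at_left t) \<longrightarrow> (v has_real_derivative - R / 4 * sin (\<theta> t)) (at_left t)"
proof -
  \<comment> \<open>The sign condition on \<open>u\<close> makes this force coefficient nonnegative
    on the left half.\<close>
  define w where "w t = - u t / 4" for t
  obtain B where B: "\<forall>t\<in>{0..1}. \<bar>u t\<bar> \<le> B" using piecewise_continuous_limits(4)[OF pc] by blast
  \<comment> \<open>The sign condition covers only \<open>[0, 1/2)\<close>, while the pendulum runs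
    up to 1/2; antisymmetry supplies the value there.\<close>
  have "u (1/2) = 0" using antisym[rule_format, of "1/2"] by simp
  then have u_le: "u t \<le> 0" if "t \<in> {0..1/2}" for t
    using neg that by (metis atLeastAtMost_iff atLeastLessThan_iff less_eq_real_def order_refl)
  have "u integrable_on {0..1/2}"
    using piecewise_continuous_limits(5)[OF pc] by (rule integrable_on_subinterval) auto
  then have wi: "w integrable_on {0..1/2}" 
    using integrable_on_cmult_left[of u "{0..1/2}" "- 1/4"] by (simp add: w_def[abs_def])
  have w_bd: "0 \<le> w t \<and> w t \<le> B" if "t \<in> {0..1/2}" for t
    using u_le[OF that] B[rule_format, of t] that by (auto simp: w_def)
  interpret pendulum w B "1/2"
  proof
    show "w absolutely_integrable_on {0..1/2}"
      by (rule absolutely_integrable_integrable_bound[where g = "\<lambda>_. B"])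
        (use wi w_bd in auto)
  qed (use w_bd in auto)
  have "0 < w t" if "t \<in> {0..<1/2}" for t using neg that by (simp add: w_def)
  then obtain a x where a: "0 < a" and x: "continuous_on {0..1/2} x" "x (1/2) = pi / 2"
    and fix_eq: "\<And>t. t \<in> {0..1/2} \<Longrightarrow> x t = a + integral {0..t} (vel x)"
    using shooting by metis
  \<comment> \<open>In this range the sine is positive, so the absolute value in the force
    disappears.\<close>
  have x_ge: "a \<le> x t" and x_le: "x t \<le> pi / 2" if t: "t \<in> {0..1/2}" for t
  proof -
    show "a \<le> x t" unfolding fix_eq[OF t] using t
      by (auto intro!: integral_nonneg vel_integrable[OF x(1)] vel_nonneg[OF x(1)])
    have i: "vel x integrable_on {0..1/2}" by (rule vel_integrable[OF x(1) order_refl])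
    then have "integral {0..t} (vel x) + integral {t..1/2} (vel x) = integral {0..1/2} (vel x)"
      using t by (intro Henstock_Kurzweil_Integration.integral_combine) auto
    moreover have "0 \<le> integral {t..1/2} (vel x)"
      using t by (intro integral_nonneg integrable_on_subinterval[OF i] vel_nonneg[OF x(1)]) auto
    ultimately show "x t \<le> pi / 2" using x(2) fix_eq[OF t] fix_eq[of "1/2"] by simp
  qed
  have sin_pos: "0 < sin (x t)" if "t \<in> {0..1/2}" for t
    using x_ge[OF that] x_le[OF that] a pi_gt_zero by (intro sin_gt_zero) linarith+
  have vel_pos: "0 < vel x t" if t: "t \<in> {0<..1/2}" for t
    unfolding vel_def
  proof (rule integral_pos_interval)
    show "(\<lambda>r. w r * \<bar>sin (x r)\<bar>) absolutely_integrable_on {0..t}"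
      using t by (intro absolutely_integrable_on_subinterval[OF force_absolutely_integrable[OF x(1)]]) auto
    show "0 \<le> w r * \<bar>sin (x r)\<bar>" if "r \<in> {0..t}" for r using w_bd[of r] that t by auto
    show "0 < w r * \<bar>sin (x r)\<bar>" if "r \<in> {0<..<t}" for r
      using sin_pos[of r] neg[rule_format, of r] that t by (auto simp: w_def mult_neg_pos)
  qed (use t in auto)
  have vel_right: "(vel x has_real_derivative - R / 4 * sin (x t)) (at_right t)"
    if t: "t \<in> {0..<1/2}" and R: "(u \<longlongrightarrow> R) (at_right t)" for t R
    unfolding vel_def
  proof (rule integral_has_derivative_at_right[OF force_integrable[OF x(1) order_refl]])
    have "(x \<longlongrightarrow> x t) (at t within {t..1/2})"
      using x(1) t continuous_on_subset[OF x(1), of "{t..1/2}"] by (auto simp: continuous_on_def)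
    then have "(x \<longlongrightarrow> x t) (at_right t)" using t by (simp add: at_within_Icc_at_right)
    then have "((\<lambda>r. w r * \<bar>sin (x r)\<bar>) \<longlongrightarrow> - R / 4 * \<bar>sin (x t)\<bar>) (at_right t)"
      unfolding w_def by (intro tendsto_intros R) auto
    then show "((\<lambda>r. w r * \<bar>sin (x r)\<bar>) \<longlongrightarrow> - R / 4 * sin (x t)) (at_right t)"
      using sin_pos[of t] t by simp
  qed (use t in auto)
  have vel_left: "(vel x has_real_derivative - R / 4 * sin (x t)) (at_left t)"
    if t: "t \<in> {0<..1/2}" and R: "(u \<longlongrightarrow> R) (at_left t)" for t R
    unfolding vel_def
  proof (rule integral_has_derivative_at_left[OF force_integrable[OF x(1) order_refl]])
    have "(x \<longlongrightarrow> x t) (at t within {0..t})"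
      using x(1) t continuous_on_subset[OF x(1), of "{0..t}"] by (auto simp: continuous_on_def)
    then have "(x \<longlongrightarrow> x t) (at_left t)" using t by (simp add: at_within_Icc_at_left)
    then have "((\<lambda>r. w r * \<bar>sin (x r)\<bar>) \<longlongrightarrow> - R / 4 * \<bar>sin (x t)\<bar>) (at_left t)"
      unfolding w_def by (intro tendsto_intros R) auto
    then show "((\<lambda>r. w r * \<bar>sin (x r)\<bar>) \<longlongrightarrow> - R / 4 * sin (x t)) (at_left t)"
      using sin_pos[of t] t by simp
  qed (use t in auto)
  \<comment> \<open>The velocity is extended evenly about 1/2, so that its primitive
    \<open>\<theta>\<close> becomes point symmetric about \<open>(1/2, pi / 2)\<close>.\<close>
  define v where "v t = vel x (min t (1 - t))" for t
  define \<theta> where "\<theta> t = a + integral {0..t} v" for t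
  have v_cont: "continuous_on {0..1} v"
    unfolding v_def
  proof (rule continuous_on_compose2[OF vel_continuous[OF x(1)]])
    show "continuous_on {0..1} (\<lambda>t::real. min t (1 - t))" by (intro continuous_intros)
  qed (auto simp: min_def)
  have v_sym: "v (1 - t) = v t" for t by (simp add: v_def min.commute)
  have v_vel: "v t = vel x t" if "t \<le> 1/2" for t using that by (simp add: v_def min_def)
  have \<theta>_x: "\<theta> t = x t" if "t \<in> {0..1/2}" for t
  proof -
    have "integral {0..t} v = integral {0..t} (vel x)"
      using that by (intro integral_cong v_vel) auto
    then show ?thesis unfolding \<theta>_def using fix_eq[OF that] by simp
  qed
  have \<theta>': "(\<theta> has_real_derivative v t) (at t within {0..1})" if "t \<in> {0..1}" for t
    using DERIV_add[OF DERIV_const integral_has_real_derivative[OF v_cont that], of a]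
    by (simp add: \<theta>_def[abs_def])
  have \<theta>_sym: "\<theta> t + \<theta> (1 - t) = pi" if t: "t \<in> {0..1}" for t
  proof -
    have d: "((\<lambda>t. \<theta> t + \<theta> (1 - t)) has_real_derivative 0) (at s within {0..1})" if s: "s \<in> {0..1}" for s
    proof -
      have "(\<lambda>s. 1 - s) ` {0..1} = {0..1::real}" by (auto intro!: image_eqI[of _ _ "1 - _"])
      then have "(\<theta> \<circ> (\<lambda>s. 1 - s) has_real_derivative v (1 - s) * - 1) (at s within {0..1})"
        using \<theta>'[of "1 - s"] s by (intro DERIV_image_chain) (auto intro!: derivative_eq_intros)
      from DERIV_add[OF \<theta>'[OF s] this] show ?thesis by (simp add: v_sym)
    qed
    have "\<exists>c. \<forall>s\<in>{0..1}. \<theta> s + \<theta> (1 - s) = c"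
      by (rule has_field_derivative_zero_constant) (use d in auto)
    then obtain c where c: "\<forall>s\<in>{0..1}. \<theta> s + \<theta> (1 - s) = c" by blast
    from c[rule_format, of "1/2"] have "c = pi" using \<theta>_x[of "1/2"] x(2) by simp
    then show ?thesis using c t by simp
  qed
  have sin_sym: "sin (\<theta> (1 - t)) = sin (\<theta> t)" if "t \<in> {0..1}" for t
  proof -
    have "\<theta> (1 - t) = pi - \<theta> t" using \<theta>_sym[OF that] by simp
    then show ?thesis by simp
  qed
  have v_right: "(v has_real_derivative - R / 4 * sin (\<theta> t)) (at_right t)"
    if t: "t \<in> {0..<1/2}" and R: "(u \<longlongrightarrow> R) (at_right t)" for t R
  proof -
    have "t < 1/2" using t by simp
    then have ev: "\<forall>\<^sub>F s in at_right t. v s = vel x s"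
      unfolding eventually_at_right[OF \<open>t < 1/2\<close>] by (intro exI[of _ "1/2"]) (auto simp: v_vel)
    show ?thesis
      using vel_right[OF t R] t \<theta>_x[of t]
      by (subst has_field_derivative_cong_eventually[OF ev]) (auto simp: v_vel)
  qed
  have v_left: "(v has_real_derivative - R / 4 * sin (\<theta> t)) (at_left t)"
    if t: "t \<in> {0<..1/2}" and R: "(u \<longlongrightarrow> R) (at_left t)" for t R
  proof -
    have "0 < t" using t by simp
    have ev: "\<forall>\<^sub>F s in at_left t. v s = vel x s"
      unfolding eventually_at_left[OF \<open>0 < t\<close>] using t by (intro exI[of _ 0]) (auto simp: v_vel)
    show ?thesis
      using vel_left[OF t R] t \<theta>_x[of t]
      by (subst has_field_derivative_cong_eventually[OF ev]) (auto simp: v_vel)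
  qed
  have refl: "- u (1 - s) = u s" if "s \<in> {0<..<1}" for s
    using antisym[rule_format, of s] that by simp
  \<comment> \<open>Reflection exchanges the two sides. The payoff changes sign, and so does the
    derivative of the even function \<open>v\<close>; the signs cancel, and the equation keeps its
    form on the right half. The midpoint is included, as the mirror image of its left-hand
    case.\<close>
  have v_right': "(v has_real_derivative - R / 4 * sin (\<theta> t)) (at_right t)"
    if t: "t \<in> {1/2..<1}" and R: "(u \<longlongrightarrow> R) (at_right t)" for t R
  proof -
    have "filterlim (\<lambda>s. 1 - s) (at_right t) (at_left (1 - t))" using filterlim_reflect_left[of "1 - t"] by simp
    from filterlim_compose[OF R this] have "((\<lambda>s. - u (1 - s)) \<longlongrightarrow> - R) (at_left (1 - t))"
      by (rule tendsto_minus)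
    moreover have "\<forall>\<^sub>F s in at_left (1 - t). - u (1 - s) = u s"
      by (rule eventually_at_leftI[of 0]) (use t refl in auto)
    ultimately have "(u \<longlongrightarrow> - R) (at_left (1 - t))" by (rule Lim_transform_eventually)
    then have "(v has_real_derivative R / 4 * sin (\<theta> (1 - t))) (at_left (1 - t))"
      using v_left[of "1 - t" "- R"] t by auto
    from has_derivative_reflect_right[OF this] show ?thesis
      using sin_sym[of t] t by (simp add: v_sym)
  qed
  have v_left': "(v has_real_derivative - R / 4 * sin (\<theta> t)) (at_left t)"
    if t: "t \<in> {1/2<..1}" and R: "(u \<longlongrightarrow> R) (at_left t)" for t R
  proof -
    have "filterlim (\<lambda>s. 1 - s) (at_left t) (at_right (1 - t))" using filterlim_reflect_right[of "1 - t"] by simp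
    from filterlim_compose[OF R this] have "((\<lambda>s. - u (1 - s)) \<longlongrightarrow> - R) (at_right (1 - t))"
      by (rule tendsto_minus)
    moreover have "\<forall>\<^sub>F s in at_right (1 - t). - u (1 - s) = u s"
      by (rule eventually_at_rightI[of _ 1]) (use t refl in auto)
    ultimately have "(u \<longlongrightarrow> - R) (at_right (1 - t))" by (rule Lim_transform_eventually)
    then have "(v has_real_derivative R / 4 * sin (\<theta> (1 - t))) (at_right (1 - t))"
      using v_right[of "1 - t" "- R"] t by auto
    from has_derivative_reflect_left[OF this] show ?thesis
      using sin_sym[of t] t by (simp add: v_sym)
  qed
  have lip: "\<bar>v t - v s\<bar> \<le> B * \<bar>t - s\<bar>" if "s \<in> {0..1}" "t \<in> {0..1}" for s t
  proof -
    have *: "\<bar>vel x q - vel x r\<bar> \<le> B * \<bar>q - r\<bar>" if "q \<in> {0..1/2}" "r \<in> {0..1/2}" for q r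
      using that
    proof (induction q r rule: linorder_wlog)
      case (le q r)
      then show ?case using vel_diff_le[OF x(1), of q r] by (simp add: abs_minus_commute)
    next
      case (sym q r)
      then show ?case by (simp add: abs_minus_commute)
    qed
    have "\<bar>v t - v s\<bar> \<le> B * \<bar>min t (1 - t) - min s (1 - s)\<bar>"
      unfolding v_def using that by (intro *) (auto simp: min_def)
    also have "\<dots> \<le> B * \<bar>t - s\<bar>"
      using W_nonneg by (intro mult_left_mono) (auto simp: min_def)
    finally show ?thesis .
  qed
  have v0: "v 0 = 0" using v_vel[of 0] by (simp add: vel_def)
  show thesis
  proof (rule that[of B \<theta> v])
    show "0 < \<theta> 0" using \<theta>_x[of 0] x_ge[of 0] a by simp
    show "v 1 = 0" using v_sym[of 0] v0 by simp
    show "\<forall>t\<in>{0<..<1}. 0 < v t" unfolding v_def by (intro ballI vel_pos) (auto simp: min_def)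
    show "\<forall>t\<in>{0..<1}. \<forall>R. (u \<longlongrightarrow> R) (at_right t) \<longrightarrow> (v has_real_derivative - R / 4 * sin (\<theta> t)) (at_right t)"
      using v_right v_right' by (metis atLeastLessThan_iff linorder_not_less)
    show "\<forall>t\<in>{0<..1}. \<forall>R. (u \<longlongrightarrow> R) (at_left t) \<longrightarrow> (v has_real_derivative - R / 4 * sin (\<theta> t)) (at_left t)"
      using v_left v_left' by (metis greaterThanAtMost_iff linorder_not_less)
  qed (use W_nonneg v0 lip \<theta>_x[of "1/2"] x(2) \<theta>' \<theta>_sym in auto)
qed

subsection \<open>Optimality\<close>

lemma ereal_integral_lebesgue_on:
  assumes "S \<in> sets lebesgue"
  shows "ereal_integral S g = enn2ereal (\<integral>\<^sup>+t. e2ennreal (g t) \<partial>lebesgue_on S) -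
    enn2ereal (\<integral>\<^sup>+t. e2ennreal (- g t) \<partial>lebesgue_on S)"
  unfolding ereal_integral_def using assms by (simp add: nn_integral_restrict_space)

lemma enn2ereal_finite: "x \<noteq> \<infinity> \<Longrightarrow> enn2ereal x = ereal (enn2real x)"
  by (cases x) auto

lemma ereal_integral_eq:
  assumes S: "S \<in> sets lebesgue" and \<gamma>: "integrable (lebesgue_on S) \<gamma>"
    and eq: "AE t in lebesgue_on S. g t = ereal (\<gamma> t)"
  shows "ereal_integral S g = ereal (integral S \<gamma>)"
proof -
  have 1: "(\<integral>\<^sup>+t. e2ennreal (g t) \<partial>lebesgue_on S) = (\<integral>\<^sup>+t. ennreal (\<gamma> t) \<partial>lebesgue_on S)"
    using eq by (intro nn_integral_cong_AE) (auto simp: ennreal.abs_eq elim!: eventually_mono)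
  have 2: "(\<integral>\<^sup>+t. e2ennreal (- g t) \<partial>lebesgue_on S) = (\<integral>\<^sup>+t. ennreal (- \<gamma> t) \<partial>lebesgue_on S)"
    using eq by (intro nn_integral_cong_AE) (auto simp: ennreal.abs_eq elim!: eventually_mono)
  have "ereal_integral S g = ereal (integral\<^sup>L (lebesgue_on S) \<gamma>)"
    unfolding ereal_integral_lebesgue_on[OF S] 1 2 real_lebesgue_integral_def[OF \<gamma>]
    using \<gamma> by (simp add: enn2ereal_finite real_integrable_def)
  then show ?thesis using lebesgue_integral_eq_integral[OF \<gamma> S] by simp
qed

text \<open>The function \<open>r\<close> is known to be integrable only in the gauge sense. The
  bound \<open>- B\<close> on a set of finite measure keeps the negative part of \<open>g\<close>
  finite. If the positive part is infinite, nothing is left to show; otherwise \<open>g\<close> is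
  finite almost everywhere and Lebesgue integrable, hence gauge integrable, and the two gauge
  integrals can be compared.\<close>

lemma ereal_integral_ge:
  assumes S: "S \<in> lmeasurable" and g: "g \<in> borel_measurable (lebesgue_on S)"
    and lb: "\<And>t. t \<in> S \<Longrightarrow> ereal (- B) \<le> g t" and r: "(r has_integral I) S"
    and le: "AE t in lebesgue_on S. ereal (r t) \<le> g t"
  shows "ereal I \<le> ereal_integral S g"
proof -
  let ?M = "lebesgue_on S"
  have S': "S \<in> sets lebesgue" using S by auto
  have [measurable]: "g \<in> borel_measurable ?M" by (rule g)
  have N: "(\<integral>\<^sup>+t. e2ennreal (- g t) \<partial>?M) < \<infinity>"
  proof -
    have "(\<integral>\<^sup>+t. e2ennreal (- g t) \<partial>?M) \<le> (\<integral>\<^sup>+t. ennreal B \<partial>?M)"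
    proof (rule nn_integral_mono)
      fix t assume "t \<in> space ?M"
      then have "- g t \<le> ereal B" using lb[of t] by (cases "g t") auto
      then show "e2ennreal (- g t) \<le> ennreal B" using e2ennreal_mono by (metis e2ennreal_ereal)
    qed
    also have "\<dots> < \<infinity>" using S
      by (simp add: emeasure_restrict_space S' ennreal_mult_less_top fmeasurable_def)
    finally show ?thesis .
  qed
  show ?thesis
  proof (cases "(\<integral>\<^sup>+t. e2ennreal (g t) \<partial>?M) = \<infinity>")
    case True
    then have "ereal_integral S g = \<infinity>"
      unfolding ereal_integral_lebesgue_on[OF S'] using N
      by (cases "\<integral>\<^sup>+t. e2ennreal (- g t) \<partial>?M") auto
    then show ?thesis by simp
  next
    case False
    then have "AE t in ?M. e2ennreal (g t) \<noteq> \<infinity>"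
      by (intro nn_integral_noteq_infinite) auto
    then have eq: "AE t in ?M. g t = ereal (real_of_ereal (g t))"
      using AE_space by eventually_elim (use lb in \<open>force simp: ereal_real\<close>)
    have "integrable ?M (\<lambda>t. real_of_ereal (g t))"
    proof (rule integrableI_bounded)
      have "(\<integral>\<^sup>+t. ennreal (norm (real_of_ereal (g t))) \<partial>?M) \<le>
          (\<integral>\<^sup>+t. e2ennreal (g t) + e2ennreal (- g t) \<partial>?M)"
      proof (rule nn_integral_mono)
        fix t
        show "ennreal (norm (real_of_ereal (g t))) \<le> e2ennreal (g t) + e2ennreal (- g t)"
          by (cases "g t") (auto simp: abs_real_def ennreal_neg)
      qed
      also have "\<dots> = (\<integral>\<^sup>+t. e2ennreal (g t) \<partial>?M) + (\<integral>\<^sup>+t. e2ennreal (- g t) \<partial>?M)"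
        by (intro nn_integral_add) auto
      also have "\<dots> < \<infinity>" using False N by (simp add: less_top)
      finally show "(\<integral>\<^sup>+t. ennreal (norm (real_of_ereal (g t))) \<partial>?M) < \<infinity>" .
    qed simp
    note J = ereal_integral_eq[OF S' this eq] and int = integrable_on_lebesgue_on[OF this S']
    obtain N where N: "negligible N" "\<And>t. t \<in> S - N \<Longrightarrow> r t \<le> real_of_ereal (g t)"
    proof -
      have "AE t in ?M. r t \<le> real_of_ereal (g t)"
        using le eq by eventually_elim (metis ereal_less_eq(3))
      then have "AE t in lebesgue. t \<in> S \<longrightarrow> r t \<le> real_of_ereal (g t)"
        using S' by (simp add: AE_restrict_space_iff)
      then obtain N where "N \<in> null_sets lebesgue" "{t. \<not> (t \<in> S \<longrightarrow> r t \<le> real_of_ereal (g t))} \<subseteq> N"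
        unfolding eventually_ae_filter by auto
      then show ?thesis using that[of N] by (auto simp: negligible_iff_null_sets)
    qed
    \<comment> \<open>The comparison of gauge integrals asks for the inequality at every point of
      \<open>S\<close>, so \<open>g\<close> is replaced by \<open>r\<close> on the null set.\<close>
    define \<gamma> where "\<gamma> t = (if t \<in> N then r t else real_of_ereal (g t))" for t
    have "(\<gamma> has_integral integral S (\<lambda>t. real_of_ereal (g t))) S"
      by (rule has_integral_spike[OF N(1) _ integrable_integral[OF int]]) (simp add: \<gamma>_def)
    then have "I \<le> integral S (\<lambda>t. real_of_ereal (g t))"
      by (rule has_integral_le[OF r]) (use N in \<open>auto simp: \<gamma>_def\<close>)
    then show ?thesis using J by simp
  qed
qed

text \<open>The end points are put into \<open>N\<close> because the two-sided \<open>deriv\<close>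
  there depends on values of \<open>q\<close> outside the interval.\<close>

lemma abs_cont_on_has_derivative_ae:
  assumes "abs_cont_on a b q"
  obtains N where "negligible N" "a \<in> N" "b \<in> N"
    "\<And>t. t \<in> {a..b} - N \<Longrightarrow> (q has_real_derivative deriv q t) (at t)"
proof
  let ?N = "{x \<in> {a<..<b}. \<not> q differentiable at x} \<union> {a, b}"
  show "negligible ?N"
    using abs_cont_on_differentiable_ae[OF assms] by (intro negligible_Un) auto
  show "(q has_real_derivative deriv q t) (at t)" if "t \<in> {a..b} - ?N" for t
    using that by (auto simp: real_differentiable_def DERIV_deriv_iff_real_differentiable)
qed auto

lemma info_cost_nonneg:
  assumes "q t \<in> {0..1}"
  shows "0 \<le> info_cost q t"
  using assms by (auto simp: info_cost_def)

text \<open>The quotient \<open>y\<^sup>2 / H\<close> lies above its tangent \<open>2 l y - l\<^sup>2 H\<close> in \<open>(y, H)\<close>.\<close>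

lemma info_cost_ge:
  assumes "q t \<in> {0..1}"
  shows "ereal (2 * l * deriv q t - l\<^sup>2 * (q t * (1 - q t))) \<le> info_cost q t"
proof (cases "q t \<in> {0, 1}")
  case True
  \<comment> \<open>Here \<open>q t * (1 - q t) = 0\<close>, so the left side is
    \<open>2 * l * deriv q t\<close>; it is 0 when the cost is 0, and otherwise the cost is
    infinite.\<close>
  then show ?thesis by (auto simp: info_cost_def)
next
  case False
  define H where "H = q t * (1 - q t)"
  have H: "0 < H" using False assms by (auto simp: H_def)
  have "0 \<le> (deriv q t - l * H)\<^sup>2" by simp
  then have "(2 * l * deriv q t - l\<^sup>2 * H) * H \<le> (deriv q t)\<^sup>2"
    by (simp add: power2_eq_square algebra_simps)
  then have "2 * l * deriv q t - l\<^sup>2 * H \<le> (deriv q t)\<^sup>2 / H"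
    using H by (simp add: pos_le_divide_eq)
  then show ?thesis using False by (simp add: info_cost_def H_def)
qed

section \<open>The stationary path, its costate and the comparison with competitors\<close>

locale stationary =
  fixes u \<theta> v :: "real \<Rightarrow> real" and W :: real
  assumes pc: "piecewise_continuous u"
    and W: "0 \<le> W" and \<theta>_0: "0 < \<theta> 0" and \<theta>_half: "\<theta> (1/2) = pi / 2"
    and v_0: "v 0 = 0" and v_1: "v 1 = 0"
    and \<theta>_deriv: "\<forall>t\<in>{0..1}. (\<theta> has_real_derivative v t) (at t within {0..1})"
    and \<theta>_sym: "\<forall>t\<in>{0..1}. \<theta> t + \<theta> (1 - t) = pi"
    and v_pos: "\<forall>t\<in>{0<..<1}. 0 < v t"
    and v_lip: "\<forall>s\<in>{0..1}. \<forall>t\<in>{0..1}. \<bar>v t - v s\<bar> \<le> W * \<bar>t - s\<bar>"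
    and v_right: "\<forall>t\<in>{0..<1}. \<forall>R. (u \<longlongrightarrow> R) (at_right t) \<longrightarrow>
      (v has_real_derivative - R / 4 * sin (\<theta> t)) (at_right t)"
    and v_left: "\<forall>t\<in>{0<..1}. \<forall>R. (u \<longlongrightarrow> R) (at_left t) \<longrightarrow>
      (v has_real_derivative - R / 4 * sin (\<theta> t)) (at_left t)"
begin

definition p :: "real \<Rightarrow> real" where "p t = (1 - cos (\<theta> t)) / 2"

text \<open>The costate is \<open>2 \<lambda>\<close>: it equals \<open>2 p' / (p (1 - p))\<close>, the derivative of the cost in \<open>p'\<close>.\<close>

definition lam :: "real \<Rightarrow> real" where "lam t = 2 * v t / sin (\<theta> t)"

lemma \<theta>_continuous: "continuous_on {0..1} \<theta>"
  by (rule DERIV_continuous_on[of _ _ v]) (use \<theta>_deriv in auto)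

lemma v_continuous: "continuous_on {0..1} v"
proof (rule lipschitz_on_continuous_on)
  show "lipschitz_on W {0..1} v"
    using v_lip W by (intro lipschitz_onI) (auto simp: dist_real_def)
qed

lemma \<theta>_strict_mono:
  assumes "0 \<le> s" "s < t" "t \<le> 1"
  shows "\<theta> s < \<theta> t"
proof (rule DERIV_pos_imp_increasing_open[OF assms(2)])
  fix x assume x: "s < x" "x < t"
  then have "(\<theta> has_real_derivative v x) (at x)"
    using \<theta>_deriv[rule_format, of x] at_within_Icc_at[of 0 x 1] assms by simp
  then show "\<exists>y. DERIV \<theta> x :> y \<and> 0 < y"
    using v_pos x assms by (intro exI[of _ "v x"]) auto
qed (use continuous_on_subset[OF \<theta>_continuous] assms in auto)

lemma \<theta>_mono: "0 \<le> s \<Longrightarrow> s \<le> t \<Longrightarrow> t \<le> 1 \<Longrightarrow> \<theta> s \<le> \<theta> t"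
  using \<theta>_strict_mono[of s t] by (cases "s = t") auto

lemma \<theta>_bounds:
  assumes "t \<in> {0..1}"
  shows "\<theta> 0 \<le> \<theta> t" "\<theta> t \<le> pi - \<theta> 0"
  using \<theta>_mono[of 0 t] \<theta>_mono[of t 1] \<theta>_sym[rule_format, of 0] assms by auto

text \<open>The angle stays in \<open>[\<theta> 0, pi - \<theta> 0]\<close>, which is symmetric
  about \<open>pi / 2\<close>, and the sine is smallest at the ends of that range. A positive lower
  bound keeps \<open>lam\<close> bounded and Lipschitz.\<close>

lemma sin_ge:
  assumes "t \<in> {0..1}"
  shows "sin (\<theta> 0) \<le> sin (\<theta> t)"
proof (cases "\<theta> t \<le> pi / 2")
  case True
  then show ?thesis using \<theta>_bounds[OF assms] \<theta>_0 by (intro sin_monotone_2pi_le) auto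
next
  case False
  then have "sin (\<theta> 0) \<le> sin (pi - \<theta> t)"
    using \<theta>_bounds[OF assms] \<theta>_0 by (intro sin_monotone_2pi_le) auto
  then show ?thesis by simp
qed

lemma sin_\<theta>_0_pos: "0 < sin (\<theta> 0)"
  using \<theta>_0 \<theta>_strict_mono[of 0 "1/2"] \<theta>_half by (intro sin_gt_zero) auto

lemma sin_pos: "t \<in> {0..1} \<Longrightarrow> 0 < sin (\<theta> t)"
  using sin_ge sin_\<theta>_0_pos by fastforce

lemma p_variance: "p t * (1 - p t) = (sin (\<theta> t))\<^sup>2 / 4"
proof -
  have "p t * (1 - p t) = (1 - (cos (\<theta> t))\<^sup>2) / 4"
    by (simp add: p_def power2_eq_square field_simps)
  then show ?thesis by (simp add: sin_squared_eq)
qed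

lemma p_interior:
  assumes "t \<in> {0..1}"
  shows "0 < p t" "p t < 1"
proof -
  have "\<bar>cos (\<theta> t)\<bar> < 1"
    using sin_pos[OF assms] sin_cos_squared_add[of "\<theta> t"]
    by (metis abs_square_less_1 less_add_same_cancel2 zero_less_power)
  then show "0 < p t" "p t < 1" by (auto simp: p_def abs_less_iff)
qed

text \<open>The derivative is written in the form \<open>y = l * H\<close>, the case of equality in
  the tangent bound for \<open>y^2 / H\<close>.\<close>

lemma p_deriv:
  assumes "t \<in> {0..1}"
  shows "(p has_real_derivative lam t * (p t * (1 - p t))) (at t within {0..1})"
proof -
  have "(p has_real_derivative sin (\<theta> t) * v t / 2) (at t within {0..1})"
    unfolding p_def[abs_def] using \<theta>_deriv[rule_format, OF assms]
    by (auto intro!: derivative_eq_intros)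
  moreover have "sin (\<theta> t) * v t / 2 = lam t * (p t * (1 - p t))"
    unfolding p_variance lam_def using sin_pos[OF assms] by (simp add: power2_eq_square)
  ultimately show ?thesis by simp
qed

lemma p_deriv_at:
  assumes "t \<in> {0<..<1}"
  shows "(p has_real_derivative lam t * (p t * (1 - p t))) (at t)"
  using p_deriv[of t] at_within_Icc_at[of 0 t 1] assms by simp

lemma lam_0: "lam 0 = 0" and lam_1: "lam 1 = 0"
  by (simp_all add: lam_def v_0 v_1)

lemma lam_pos: "t \<in> {0<..<1} \<Longrightarrow> 0 < lam t"
  unfolding lam_def using v_pos sin_pos by simp

lemma p_continuous: "continuous_on {0..1} p"
  unfolding p_def[abs_def] by (intro continuous_intros \<theta>_continuous) auto

lemma lam_continuous: "continuous_on {0..1} lam"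
proof -
  have "sin (\<theta> t) \<noteq> 0" if "t \<in> {0..1}" for t using sin_pos[OF that] by simp
  then show ?thesis
    unfolding lam_def[abs_def] by (intro continuous_intros \<theta>_continuous v_continuous) auto
qed

text \<open>This is the adjoint equation: \<open>(2 lam)' = - lam^2 (1 - 2 p) - u\<close> is the
  derivative of \<open>- lam^2 q (1 - q) - u q\<close> with respect to \<open>q\<close> at
  \<open>p\<close>, so first-order terms in \<open>q - p\<close> will cancel.\<close>

lemma lam_deriv:
  assumes t: "t \<in> {0<..<1}" and u: "isCont u t"
  shows "(lam has_real_derivative - (lam t)\<^sup>2 * (1 - 2 * p t) / 2 - u t / 2) (at t)"
proof -
  have "(u \<longlongrightarrow> u t) (at_left t)" "(u \<longlongrightarrow> u t) (at_right t)"
    using u filterlim_at_split[of u "nhds (u t)" t] by (auto simp: isCont_def)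
  then have "(v has_real_derivative - u t / 4 * sin (\<theta> t)) (at t)"
    using v_left[rule_format, of t] v_right[rule_format, of t] t
    by (auto simp: has_field_derivative_iff filterlim_at_split)
  moreover have "(\<theta> has_real_derivative v t) (at t)"
    using \<theta>_deriv[rule_format, of t] at_within_Icc_at[of 0 t 1] t by simp
  moreover have s: "sin (\<theta> t) \<noteq> 0" using sin_pos[of t] t by simp
  ultimately have "(lam has_real_derivative
      (2 * (- u t / 4 * sin (\<theta> t)) * sin (\<theta> t) - 2 * v t * (cos (\<theta> t) * v t)) / (sin (\<theta> t) * sin (\<theta> t))) (at t)"
    unfolding lam_def[abs_def] by (auto intro!: derivative_eq_intros)
  moreover have "(2 * (- u t / 4 * sin (\<theta> t)) * sin (\<theta> t) - 2 * v t * (cos (\<theta> t) * v t)) / (sin (\<theta> t) * sin (\<theta> t))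
      = - (lam t)\<^sup>2 * (1 - 2 * p t) / 2 - u t / 2"
    unfolding lam_def p_def using s by (simp add: field_simps power2_eq_square)
  ultimately show ?thesis by simp
qed

text \<open>The costate is a quotient of Lipschitz functions whose denominator is at least
  \<open>sin (\<theta> 0) > 0\<close>; this is where distance of \<open>p\<close> from 0 and 1
  enters.\<close>

lemma lipschitz_constants:
  obtains M L P where "0 \<le> M" "0 \<le> L" "0 \<le> P" "\<And>t. t \<in> {0..1} \<Longrightarrow> \<bar>lam t\<bar> \<le> M"
    "\<And>s t. s \<in> {0..1} \<Longrightarrow> t \<in> {0..1} \<Longrightarrow> \<bar>lam t - lam s\<bar> \<le> L * \<bar>t - s\<bar>"
    "\<And>s t. s \<in> {0..1} \<Longrightarrow> t \<in> {0..1} \<Longrightarrow> \<bar>p t - p s\<bar> \<le> P * \<bar>t - s\<bar>"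
proof -
  define \<sigma> where "\<sigma> = sin (\<theta> 0)"
  have \<sigma>: "0 < \<sigma>" "\<And>t. t \<in> {0..1} \<Longrightarrow> \<sigma> \<le> sin (\<theta> t)"
    using sin_\<theta>_0_pos sin_ge by (auto simp: \<sigma>_def)
  have v_le: "\<bar>v t\<bar> \<le> W" if "t \<in> {0..1}" for t
  proof -
    have "\<bar>v t\<bar> \<le> W * \<bar>t\<bar>" using v_lip[rule_format, of 0 t] that v_0 by auto
    also have "\<dots> \<le> W * 1" using that W by (intro mult_left_mono) auto
    finally show ?thesis by simp
  qed
  have lip: "\<bar>f t - f s\<bar> \<le> B * \<bar>t - s\<bar>"
    if f: "\<And>t. t \<in> {0..1} \<Longrightarrow> (f has_real_derivative f' t) (at t within {0..1})"
      "\<And>t. t \<in> {0..1} \<Longrightarrow> \<bar>f' t\<bar> \<le> B" and st: "s \<in> {0..1}" "t \<in> {0..1}"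
    for f f' :: "real \<Rightarrow> real" and B s t
    using field_differentiable_bound[of "{0..1}" f f' B t s] f st by (simp add: real_norm_def)
  have sin_lip: "\<bar>sin (\<theta> t) - sin (\<theta> s)\<bar> \<le> W * \<bar>t - s\<bar>" if "s \<in> {0..1}" "t \<in> {0..1}" for s t
  proof (rule lip[OF _ _ that])
    fix t :: real assume t: "t \<in> {0..1}"
    show "((\<lambda>t. sin (\<theta> t)) has_real_derivative cos (\<theta> t) * v t) (at t within {0..1})"
      using \<theta>_deriv[rule_format, OF t] by (auto intro!: derivative_eq_intros)
    show "\<bar>cos (\<theta> t) * v t\<bar> \<le> W"
      using mult_mono[of "\<bar>cos (\<theta> t)\<bar>" 1 "\<bar>v t\<bar>" W] v_le[OF t] by (simp add: abs_mult)
  qed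
  have p_lip: "\<bar>p t - p s\<bar> \<le> W / 2 * \<bar>t - s\<bar>" if "s \<in> {0..1}" "t \<in> {0..1}" for s t
  proof (rule lip[OF _ _ that])
    fix t :: real assume t: "t \<in> {0..1}"
    show "(p has_real_derivative sin (\<theta> t) * v t / 2) (at t within {0..1})"
      unfolding p_def[abs_def] using \<theta>_deriv[rule_format, OF t]
      by (auto intro!: derivative_eq_intros)
    show "\<bar>sin (\<theta> t) * v t / 2\<bar> \<le> W / 2"
      using mult_mono[of "\<bar>sin (\<theta> t)\<bar>" 1 "\<bar>v t\<bar>" W] v_le[OF t] by (simp add: abs_mult)
  qed
  have lam_le: "\<bar>lam t\<bar> \<le> 2 * W / \<sigma>" if "t \<in> {0..1}" for t
  proof -
    have "\<bar>lam t\<bar> = 2 * \<bar>v t\<bar> / sin (\<theta> t)"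
      using sin_pos[OF that] by (simp add: lam_def abs_mult)
    also have "\<dots> \<le> 2 * W / \<sigma>" using v_le[OF that] \<sigma> that W by (intro frac_le) auto
    finally show ?thesis .
  qed
  have lam_lip: "\<bar>lam t - lam s\<bar> \<le> (2 * W + 2 * W / \<sigma> * W) / \<sigma> * \<bar>t - s\<bar>"
    if st: "s \<in> {0..1}" "t \<in> {0..1}" for s t
  proof -
    have pos: "0 < sin (\<theta> t)" "0 < sin (\<theta> s)" using sin_pos st by auto
    \<comment> \<open>Keeping \<open>lam s\<close> as a factor leaves a single denominator and lets
      the bound on \<open>lam\<close> be reused.\<close>
    have "lam t - lam s = (2 * (v t - v s) - lam s * (sin (\<theta> t) - sin (\<theta> s))) / sin (\<theta> t)"
      using pos by (simp add: lam_def field_simps)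
    then have "\<bar>lam t - lam s\<bar> = \<bar>2 * (v t - v s) - lam s * (sin (\<theta> t) - sin (\<theta> s))\<bar> / sin (\<theta> t)"
      using pos by simp
    also have "\<dots> \<le> ((2 * W + 2 * W / \<sigma> * W) * \<bar>t - s\<bar>) / \<sigma>"
    proof (rule frac_le)
      have "\<bar>2 * (v t - v s) - lam s * (sin (\<theta> t) - sin (\<theta> s))\<bar> \<le>
          2 * \<bar>v t - v s\<bar> + \<bar>lam s\<bar> * \<bar>sin (\<theta> t) - sin (\<theta> s)\<bar>"
        using abs_triangle_ineq4[of "2 * (v t - v s)" "lam s * (sin (\<theta> t) - sin (\<theta> s))"]
        by (simp only: abs_mult abs_numeral)
      also have "\<dots> \<le> 2 * (W * \<bar>t - s\<bar>) + 2 * W / \<sigma> * (W * \<bar>t - s\<bar>)"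
        using v_lip st lam_le[OF st(1)] sin_lip[OF st] W \<sigma>(1)
        by (intro add_mono mult_mono) auto
      finally show "\<bar>2 * (v t - v s) - lam s * (sin (\<theta> t) - sin (\<theta> s))\<bar> \<le> (2 * W + 2 * W / \<sigma> * W) * \<bar>t - s\<bar>"
        by (simp add: algebra_simps)
    qed (use W \<sigma> st in auto)
    finally show ?thesis by simp
  qed
  show thesis
    by (rule that[OF _ _ _ lam_le lam_lip p_lip]) (use W \<sigma>(1) in auto)
qed

text \<open>An increment of the product splits into \<open>lam\<close> times those of
  \<open>q\<close> and \<open>p\<close>, and an increment of \<open>lam\<close> times
  \<open>q - p\<close>, which stays in \<open>[-1, 1]\<close>. Only the first part is not Lipschitz,
  and it is dominated by increments of \<open>q\<close>.\<close>

lemma weighted_difference_abs_cont: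
  assumes q: "admissible q"
  shows "abs_cont_on 0 1 (\<lambda>t. 2 * lam t * (q t - p t))"
proof -
  obtain M L P where c: "0 \<le> M" "0 \<le> L" "0 \<le> P" "\<And>t. t \<in> {0..1} \<Longrightarrow> \<bar>lam t\<bar> \<le> M"
    "\<And>s t. s \<in> {0..1} \<Longrightarrow> t \<in> {0..1} \<Longrightarrow> \<bar>lam t - lam s\<bar> \<le> L * \<bar>t - s\<bar>"
    "\<And>s t. s \<in> {0..1} \<Longrightarrow> t \<in> {0..1} \<Longrightarrow> \<bar>p t - p s\<bar> \<le> P * \<bar>t - s\<bar>"
    by (rule lipschitz_constants) blast
  have q01: "t \<in> {0..1} \<Longrightarrow> q t \<in> {0..1}" for t using q by (simp add: admissible_def)
  have tri: "\<bar>2 * (a - b + c)\<bar> \<le> 2 * (\<bar>a\<bar> + \<bar>b\<bar> + \<bar>c\<bar>)" for a b c :: real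
  proof -
    have "\<bar>a - b + c\<bar> \<le> \<bar>a\<bar> + \<bar>b\<bar> + \<bar>c\<bar>" by linarith
    then show ?thesis by (simp add: abs_mult)
  qed
  have "abs_cont_on 0 1 q" using q by (simp add: admissible_def)
  then show ?thesis
  proof (rule abs_cont_on_le[where A = "2 * M" and B = "2 * (M * P + L)"])
    fix x y :: real assume "0 \<le> x" "x \<le> y" "y \<le> 1"
    then have xy: "x \<in> {0..1}" "y \<in> {0..1}" "\<bar>y - x\<bar> = y - x" by auto
    have d: "\<bar>q x - p x\<bar> \<le> 1" using q01[OF xy(1)] p_interior[OF xy(1)] by auto
    have eq: "2 * lam y * (q y - p y) - 2 * lam x * (q x - p x) =
      2 * (lam y * (q y - q x) - lam y * (p y - p x) + (lam y - lam x) * (q x - p x))"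
      by (simp add: algebra_simps)
    have "\<bar>2 * lam y * (q y - p y) - 2 * lam x * (q x - p x)\<bar> \<le> 2 * (\<bar>lam y\<bar> * \<bar>q y - q x\<bar> + \<bar>lam y\<bar> * \<bar>p y - p x\<bar> + \<bar>lam y - lam x\<bar> * \<bar>q x - p x\<bar>)"
      unfolding eq abs_mult[symmetric] by (rule tri)
    also have "\<dots> \<le> 2 * (M * \<bar>q y - q x\<bar> + M * (P * \<bar>y - x\<bar>) + (L * \<bar>y - x\<bar>) * 1)"
      using c(1-3) c(4)[OF xy(2)] c(5,6)[OF xy(1,2)] d
      by (intro mult_left_mono add_mono mult_mono) auto
    also have "\<dots> = 2 * M * \<bar>q y - q x\<bar> + 2 * (M * P + L) * (y - x)"
      unfolding xy(3) by (simp add: algebra_simps)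
    finally show "\<bar>2 * lam y * (q y - p y) - 2 * lam x * (q x - p x)\<bar> \<le>
      2 * M * \<bar>q y - q x\<bar> + 2 * (M * P + L) * (y - x)" .
  qed (use c in auto)
qed

text \<open>The lower bound for the integrand of the functional at \<open>q\<close> given by \<open>info_cost_ge\<close>.\<close>

definition rate :: "(real \<Rightarrow> real) \<Rightarrow> real \<Rightarrow> real" where
  "rate q t = 2 * lam t * deriv q t - (lam t)\<^sup>2 * (q t * (1 - q t)) - u t * q t"

text \<open>The integrand is the exact second-order term in the expansion of
  \<open>- lam^2 q (1 - q)\<close> about \<open>p\<close>.\<close>

definition excess :: "(real \<Rightarrow> real) \<Rightarrow> real" where
  "excess q = integral {0..1} (\<lambda>t. (lam t)\<^sup>2 * (q t - p t)\<^sup>2)"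

text \<open>This is the functional at \<open>p\<close>: the relation
  \<open>p' = lam * p * (1 - p)\<close> turns its cost into
  \<open>lam^2 * p * (1 - p)\<close>.\<close>

definition val :: real where
  "val = integral {0..1} (\<lambda>t. (lam t)\<^sup>2 * (p t * (1 - p t)) - u t * p t)"

lemma admissible_continuous: "admissible q \<Longrightarrow> continuous_on {0..1} q"
  by (simp add: admissible_def abs_cont_on_imp_continuous_on)

lemma payoff_absolutely_integrable:
  assumes "continuous_on {0..1} q"
  shows "(\<lambda>t. u t * q t) absolutely_integrable_on {0..1}"
proof -
  obtain B where B: "\<forall>t\<in>{0..1}. \<bar>u t\<bar> \<le> B" using piecewise_continuous_limits(4)[OF pc] by blast
  have "u absolutely_integrable_on {0..1}"
    by (rule absolutely_integrable_integrable_bound[where g = "\<lambda>_. B"])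
      (use B piecewise_continuous_limits(5)[OF pc] in auto)
  then have "(\<lambda>t. q t * u t) absolutely_integrable_on {0..1}"
    by (intro absolutely_integrable_bounded_measurable_product_real
      continuous_imp_measurable_on_sets_lebesgue compact_imp_bounded compact_continuous_image assms) auto
  then show ?thesis by (simp add: mult.commute)
qed

lemma running_absolutely_integrable:
  "(\<lambda>t. (lam t)\<^sup>2 * (p t * (1 - p t)) - u t * p t) absolutely_integrable_on {0..1}"
  by (intro set_integral_diff payoff_absolutely_integrable p_continuous absolutely_integrable_continuous_real
    continuous_intros lam_continuous)

text \<open>With \<open>q (1 - q) = p (1 - p) + (1 - 2 p) (q - p) - (q - p)^2\<close> and the
  equations for \<open>p'\<close> and \<open>lam'\<close>, the function \<open>rate q\<close> is the
  integrand of \<open>val\<close> plus that of \<open>excess q\<close> plus the derivative of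
  \<open>2 lam (q - p)\<close>. The last part integrates to 0, since \<open>lam\<close> vanishes at
  both ends.\<close>

lemma rate_has_integral:
  assumes q: "admissible q"
  shows "(rate q has_integral val + excess q) {0..1}"
proof -
  let ?g = "\<lambda>t. 2 * lam t * (q t - p t)"
  let ?g' = "\<lambda>t. (- (lam t)\<^sup>2 * (1 - 2 * p t) - u t) * (q t - p t) + 2 * lam t * (deriv q t - lam t * (p t * (1 - p t)))"
  obtain N where N: "negligible N" "0 \<in> N" "1 \<in> N"
    "\<And>t. t \<in> {0..1} - N \<Longrightarrow> (q has_real_derivative deriv q t) (at t)"
    using q abs_cont_on_has_derivative_ae[of 0 1 q] unfolding admissible_def by metis
  obtain S where S: "finite S" "\<And>t. t \<in> {0..1} - S \<Longrightarrow> isCont u t"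
    using piecewise_continuous_limits(3)[OF pc] by blast
  have "(?g' has_integral ?g 1 - ?g 0) {0..1}"
  proof (rule abs_cont_on_has_integral[OF weighted_difference_abs_cont[OF q]])
    show "negligible (N \<union> S)" by (rule negligible_Un[OF N(1) negligible_finite[OF S(1)]])
    fix t assume t: "t \<in> {0..1} - (N \<union> S)"
    then have t': "t \<in> {0<..<1}" using N(2,3) by (cases "t = 0 \<or> t = 1") auto
    have "(?g has_real_derivative 2 * (- (lam t)\<^sup>2 * (1 - 2 * p t) / 2 - u t / 2) * (q t - p t) +
        2 * lam t * (deriv q t - lam t * (p t * (1 - p t)))) (at t)"
      using N(4)[of t] S(2)[of t] lam_deriv[OF t'] p_deriv_at[OF t'] t
      by (auto intro!: derivative_eq_intros)
    then have "(?g has_real_derivative ?g' t) (at t)"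
      by (rule DERIV_cong) (simp add: field_simps)
    then show "(?g has_real_derivative ?g' t) (at t within {0..1})" by (rule has_field_derivative_at_within)
  qed simp
  then have g': "(?g' has_integral 0) {0..1}" by (simp add: lam_0 lam_1)
  have 1: "((\<lambda>t. (lam t)\<^sup>2 * (p t * (1 - p t)) - u t * p t) has_integral val) {0..1}"
    unfolding val_def
    by (rule integrable_integral[OF set_lebesgue_integral_eq_integral(1)[OF running_absolutely_integrable]])
  have 2: "((\<lambda>t. (lam t)\<^sup>2 * (q t - p t)\<^sup>2) has_integral excess q) {0..1}"
    unfolding excess_def
    by (intro integrable_integral integrable_continuous_real continuous_intros lam_continuous
      p_continuous admissible_continuous[OF q])
  have "((\<lambda>t. ((lam t)\<^sup>2 * (p t * (1 - p t)) - u t * p t) + (lam t)\<^sup>2 * (q t - p t)\<^sup>2 + ?g' t)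
    has_integral (val + excess q + 0)) {0..1}"
    by (intro has_integral_add 1 2 g')
  moreover have "((lam t)\<^sup>2 * (p t * (1 - p t)) - u t * p t) + (lam t)\<^sup>2 * (q t - p t)\<^sup>2 + ?g' t = rate q t" for t
    unfolding rate_def by (simp add: power2_eq_square algebra_simps)
  ultimately show ?thesis by simp
qed

text \<open>Measurability of the pointwise derivative is read off from the fundamental theorem,
  since gauge integrable functions are Lebesgue measurable.\<close>

lemma deriv_measurable:
  assumes "admissible q"
  shows "deriv q \<in> borel_measurable (lebesgue_on {0..1})"
proof -
  obtain N where N: "negligible N" "\<And>t. t \<in> {0..1} - N \<Longrightarrow> (q has_real_derivative deriv q t) (at t)"
    using assms abs_cont_on_has_derivative_ae[of 0 1 q] unfolding admissible_def by metis
  have "(deriv q has_integral q 1 - q 0) {0..1}"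
    using assms N by (intro abs_cont_on_has_integral) (auto simp: admissible_def intro: has_field_derivative_at_within)
  then show ?thesis by (intro integrable_imp_measurable has_integral_integrable)
qed

lemma integrand_measurable:
  assumes "admissible q"
  shows "(\<lambda>t. info_cost q t - ereal (u t * q t)) \<in> borel_measurable (lebesgue_on {0..1})"
proof -
  have [measurable]: "deriv q \<in> borel_measurable (lebesgue_on {0..1})"
    by (rule deriv_measurable[OF assms])
  have [measurable]: "q \<in> borel_measurable (lebesgue_on {0..1})"
    using admissible_continuous[OF assms] by (intro continuous_imp_measurable_on_sets_lebesgue) auto
  have [measurable]: "u \<in> borel_measurable (lebesgue_on {0..1})"
    by (rule integrable_imp_measurable[OF piecewise_continuous_limits(5)[OF pc]])
  show ?thesis unfolding info_cost_def insert_iff empty_iff by measurable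
qed

text \<open>The tangent bound also holds where \<open>q\<close> touches 0 or 1 and where the cost is
  infinite, so every admissible competitor is covered. The cost is nonnegative and the payoff
  bounded, which supplies the lower bound on the integrand.\<close>

lemma J_ge:
  assumes q: "admissible q"
  shows "ereal (val + excess q) \<le> J\<^sub>P u q"
proof -
  obtain B where B: "\<forall>t\<in>{0..1}. \<bar>u t\<bar> \<le> B" using piecewise_continuous_limits(4)[OF pc] by blast
  have q01: "t \<in> {0..1} \<Longrightarrow> q t \<in> {0..1}" for t using q by (simp add: admissible_def)
  show ?thesis
    unfolding J\<^sub>P_def
  proof (rule ereal_integral_ge[where B = B, OF _ integrand_measurable[OF q] _ rate_has_integral[OF q]])
    fix t :: real assume t: "t \<in> {0..1}"
    have "u t * q t \<le> \<bar>u t\<bar> * \<bar>q t\<bar>" by (simp add: abs_mult[symmetric])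
    also have "\<dots> \<le> B * 1" using B t q01[OF t] by (intro mult_mono) (auto intro: order_trans[OF abs_ge_zero])
    finally have "ereal (- B) \<le> ereal (- (u t * q t))" by simp
    also have "\<dots> \<le> info_cost q t - ereal (u t * q t)"
      using info_cost_nonneg[of q t] q01[OF t] by (cases "info_cost q t") auto
    finally show "ereal (- B) \<le> info_cost q t - ereal (u t * q t)" .
  next
    have "ereal (rate q t) \<le> info_cost q t - ereal (u t * q t)" if "t \<in> {0..1}" for t
      using info_cost_ge[of q t "lam t"] q01[OF that] unfolding rate_def by (cases "info_cost q t") auto
    then show "AE t in lebesgue_on {0..1}. ereal (rate q t) \<le> info_cost q t - ereal (u t * q t)"
      by (intro AE_I2) simp
  qed auto
qed

lemma J_p: "J\<^sub>P u p = ereal val"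
  unfolding J\<^sub>P_def val_def
proof (rule ereal_integral_eq)
  show "integrable (lebesgue_on {0..1}) (\<lambda>t. (lam t)\<^sup>2 * (p t * (1 - p t)) - u t * p t)"
    using running_absolutely_integrable by (simp add: integrable_restrict_space set_integrable_def)
  \<comment> \<open>At the end points \<open>deriv p\<close> depends on values of \<open>p\<close>
    outside \<open>[0, 1]\<close>, so they are discarded.\<close>
  have "AE t in lebesgue_on {0..1}. t \<notin> {0, 1::real}"
  proof -
    have Icc_meas: "{0..1::real} \<inter> space lebesgue \<in> sets lebesgue" by simp
    have "{0, 1::real} \<in> null_sets lebesgue" using negligible_iff_null_sets negligible_finite by blast
    then have "AE t in lebesgue. t \<notin> {0, 1::real}" by (rule AE_not_in)
    then show ?thesis unfolding AE_restrict_space_iff[OF Icc_meas] by (rule AE_mp) simp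
  qed
  then show "AE t in lebesgue_on {0..1}.
      info_cost p t - ereal (u t * p t) = ereal ((lam t)\<^sup>2 * (p t * (1 - p t)) - u t * p t)"
    using AE_space
  proof eventually_elim
    case (elim t)
    then have t: "t \<in> {0<..<1}" by auto
    have "0 < p t" "p t < 1" using p_interior[of t] t by auto
    then show ?case
      using DERIV_imp_deriv[OF p_deriv_at[OF t]]
      by (auto simp: info_cost_def power2_eq_square)
  qed
qed auto

lemma p_admissible: "admissible p"
  unfolding admissible_def
proof
  obtain M L P where c: "0 \<le> P"
    "\<And>s t. s \<in> {0..1} \<Longrightarrow> t \<in> {0..1} \<Longrightarrow> \<bar>p t - p s\<bar> \<le> P * \<bar>t - s\<bar>"
    by (rule lipschitz_constants) blast
  show "abs_cont_on 0 1 p"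
  \<comment> \<open>A Lipschitz function is dominated by the zero function plus a multiple of the
    length.\<close>
  proof (rule abs_cont_on_le[where f = "\<lambda>_. 0" and A = 0 and B = P])
    show "abs_cont_on 0 1 (\<lambda>_. 0)" unfolding abs_cont_on_def by (auto intro: exI[of _ 1])
    show "\<bar>p y - p x\<bar> \<le> 0 * \<bar>0 - 0\<bar> + P * (y - x)" if "0 \<le> x" "x \<le> y" "y \<le> 1" for x y
      using c(2)[of x y] that by simp
  qed (use c in auto)
  show "\<forall>t\<in>{0..1}. p t \<in> {0..1}" using p_interior by (auto simp: less_imp_le)
qed

lemma excess_nonneg: "admissible q \<Longrightarrow> 0 \<le> excess q"
  unfolding excess_def by (intro integral_nonneg integrable_continuous_real continuous_intros lam_continuous
      p_continuous admissible_continuous) auto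

theorem p_optimal: "optimal_solution u p"
  unfolding optimal_solution_def
proof (intro conjI allI impI p_admissible)
  show "\<bar>J\<^sub>P u p\<bar> \<noteq> \<infinity>" by (simp add: J_p)
  fix q assume q: "admissible q"
  have "ereal val \<le> ereal (val + excess q)" using excess_nonneg[OF q] by simp
  also have "\<dots> \<le> J\<^sub>P u q" by (rule J_ge[OF q])
  finally show "J\<^sub>P u p \<le> J\<^sub>P u q" by (simp add: J_p)
qed

theorem optimal_unique:
  assumes "optimal_solution u q" "t \<in> {0..1}"
  shows "q t = p t"
proof -
  have q: "admissible q" "J\<^sub>P u q \<le> J\<^sub>P u p"
    using assms p_admissible by (auto simp: optimal_solution_def)
  note cont = lam_continuous p_continuous admissible_continuous[OF q(1)]
  have "ereal (val + excess q) \<le> ereal val" using order_trans[OF J_ge[OF q(1)] q(2)] unfolding J_p .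
  then have "excess q = 0" using excess_nonneg[OF q(1)] by simp
  then have 0: "\<forall>t\<in>{0..1}. (lam t)\<^sup>2 * (q t - p t)\<^sup>2 = 0"
    unfolding excess_def by (subst (asm) integral_eq_0_iff) (auto intro!: continuous_intros cont)
  \<comment> \<open>The weight \<open>lam^2\<close> is positive only inside the interval and
    vanishes at 0 and 1; continuity carries the equality to the end points.\<close>
  have "q t - p t = 0" if "t \<in> closure {0<..<1}" for t
  proof (rule continuous_constant_on_closure[OF _ _ that])
    show "continuous_on (closure {0<..<1}) (\<lambda>t. q t - p t)"
      using cont by (auto intro!: continuous_intros)
    show "q t - p t = 0" if "t \<in> {0<..<1}" for t using 0[rule_format, of t] lam_pos[OF that] that by auto
  qed
  then show ?thesis using assms(2) by simp
qed

end

subsection \<open>Curvature\<close>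

context stationary
begin

definition p1 :: "real \<Rightarrow> real" where "p1 t = sin (\<theta> t) * v t / 2"

lemma p_deriv_p1: "t \<in> {0..1} \<Longrightarrow> (p has_real_derivative p1 t) (at t within {0..1})"
  unfolding p_def[abs_def] p1_def using \<theta>_deriv
  by (auto intro!: derivative_eq_intros)

text \<open>The set \<open>S\<close> stays arbitrary so that one product rule serves left, right and
  relative derivatives; \<open>R\<close> is the value or one-sided limit of the payoff that drives
  \<open>v\<close>.\<close>

lemma p1_deriv:
  assumes "(v has_real_derivative - R / 4 * sin (\<theta> t)) (at t within S)"
    "(\<theta> has_real_derivative v t) (at t within S)"
  shows "(p1 has_real_derivative cos (\<theta> t) * (v t)\<^sup>2 / 2 - R * (sin (\<theta> t))\<^sup>2 / 8) (at t within S)"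
  unfolding p1_def[abs_def] using assms
  by (auto intro!: derivative_eq_intros simp: power2_eq_square field_simps)

lemma second_derivative_right:
  assumes t: "t \<in> {0..<1}" and R: "(u \<longlongrightarrow> R) (at_right t)"
  shows "has_second_derivative p (cos (\<theta> t) * (v t)\<^sup>2 / 2 - R * (sin (\<theta> t))\<^sup>2 / 8) (at_right t)"
  unfolding has_second_derivative_def
proof (intro exI[of _ p1] conjI ballI p_deriv_p1 p1_deriv)
  show "(v has_real_derivative - R / 4 * sin (\<theta> t)) (at_right t)" using v_right t R by blast
  have "(\<theta> has_real_derivative v t) (at t within {t..1})"
    by (rule has_field_derivative_subset[OF \<theta>_deriv[rule_format]]) (use t in auto)
  then show "(\<theta> has_real_derivative v t) (at_right t)" using t by (simp add: at_within_Icc_at_right)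
qed

lemma second_derivative_left:
  assumes t: "t \<in> {0<..1}" and R: "(u \<longlongrightarrow> R) (at_left t)"
  shows "has_second_derivative p (cos (\<theta> t) * (v t)\<^sup>2 / 2 - R * (sin (\<theta> t))\<^sup>2 / 8) (at_left t)"
  unfolding has_second_derivative_def
proof (intro exI[of _ p1] conjI ballI p_deriv_p1 p1_deriv)
  show "(v has_real_derivative - R / 4 * sin (\<theta> t)) (at_left t)" using v_left t R by blast
  have "(\<theta> has_real_derivative v t) (at t within {0..t})"
    by (rule has_field_derivative_subset[OF \<theta>_deriv[rule_format]]) (use t in auto)
  then show "(\<theta> has_real_derivative v t) (at_left t)" using t by (simp add: at_within_Icc_at_left)
qed

lemma second_derivative_continuous:
  assumes t: "t \<in> {0..1}" and u: "continuous (at t within {0..1}) u"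
  shows "has_second_derivative p (cos (\<theta> t) * (v t)\<^sup>2 / 2 - u t * (sin (\<theta> t))\<^sup>2 / 8) (at t within {0..1})"
  unfolding has_second_derivative_def
proof (intro exI[of _ p1] conjI ballI p_deriv_p1 p1_deriv)
  have lim: "(u \<longlongrightarrow> u t) (at t within {0..1})" using u by (simp add: continuous_within)
  show "(v has_real_derivative - u t / 4 * sin (\<theta> t)) (at t within {0..1})"
  proof -
    consider "t = 0" | "t = 1" | "0 < t" "t < 1" using t by fastforce
    then show ?thesis
    proof cases
      case 1
      then show ?thesis using v_right[rule_format, of t "u t"] lim by (simp add: at_within_Icc_at_right)
    next
      case 2
      then show ?thesis using v_left[rule_format, of t "u t"] lim by (simp add: at_within_Icc_at_left)
    next
      case 3
      then have at: "at t within {0..1} = at t" by (rule at_within_Icc_at)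
      then have "(u \<longlongrightarrow> u t) (at_left t)" "(u \<longlongrightarrow> u t) (at_right t)"
        using lim filterlim_at_split[of u "nhds (u t)" t] by auto
      then show ?thesis
        using v_left[rule_format, of t] v_right[rule_format, of t] 3 unfolding at
        by (auto simp: has_field_derivative_iff filterlim_at_split)
    qed
  qed
qed (use \<theta>_deriv t in auto)

lemma cos_pos: "t \<in> {0..<1/2} \<Longrightarrow> 0 < cos (\<theta> t)"
  using \<theta>_strict_mono[of t "1/2"] \<theta>_half \<theta>_bounds[of t] \<theta>_0 by (intro cos_gt_zero) auto

lemma cos_neg:
  assumes "t \<in> {1/2<..1}"
  shows "cos (\<theta> t) < 0"
proof -
  have "0 < cos (\<theta> (1 - t))" using assms by (intro cos_pos) auto
  moreover have "\<theta> (1 - t) = pi - \<theta> t" using \<theta>_sym[rule_format, of t] assms by auto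
  ultimately show ?thesis by simp
qed

text \<open>Both terms have the right sign: \<open>p\<close> is below 1/2, so the cosine is
  positive, and the payoff limit is not positive. At \<open>t = 0\<close> the velocity vanishes, and
  the payoff term has to be strict by itself.\<close>

lemma curvature_pos:
  assumes t: "t \<in> {0..<1/2}" and R: "R \<le> 0" "t \<noteq> 0 \<or> R \<noteq> 0"
  shows "0 < cos (\<theta> t) * (v t)\<^sup>2 / 2 - R * (sin (\<theta> t))\<^sup>2 / 8"
proof -
  have c: "0 < cos (\<theta> t)" and s: "0 < sin (\<theta> t)" using cos_pos[OF t] sin_pos[of t] t by auto
  have v: "0 < v t" if "t \<noteq> 0" using v_pos t that by simp
  have 1: "0 \<le> cos (\<theta> t) * (v t)\<^sup>2" "t \<noteq> 0 \<Longrightarrow> 0 < cos (\<theta> t) * (v t)\<^sup>2" using c v by auto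
  have 2: "R * (sin (\<theta> t))\<^sup>2 \<le> 0" "R \<noteq> 0 \<Longrightarrow> R * (sin (\<theta> t))\<^sup>2 < 0"
    using s R(1) by (auto simp: mult_nonpos_nonneg intro!: mult_neg_pos)
  show ?thesis using 1 2 R(2) by (cases "t = 0") auto
qed

lemma curvature_neg:
  assumes t: "t \<in> {1/2<..1}" and R: "0 \<le> R" "t \<noteq> 1 \<or> R \<noteq> 0"
  shows "cos (\<theta> t) * (v t)\<^sup>2 / 2 - R * (sin (\<theta> t))\<^sup>2 / 8 < 0"
proof -
  have c: "cos (\<theta> t) < 0" and s: "0 < sin (\<theta> t)" using cos_neg[OF t] sin_pos[of t] t by auto
  have v: "0 < v t" if "t \<noteq> 1" using v_pos t that by simp
  have 1: "cos (\<theta> t) * (v t)\<^sup>2 \<le> 0" "t \<noteq> 1 \<Longrightarrow> cos (\<theta> t) * (v t)\<^sup>2 < 0"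
    using c v by (auto simp: mult_nonpos_nonneg intro!: mult_neg_pos)
  have 2: "0 \<le> R * (sin (\<theta> t))\<^sup>2" "R \<noteq> 0 \<Longrightarrow> 0 < R * (sin (\<theta> t))\<^sup>2"
    using s R(1) by auto
  show ?thesis using 1 2 R(2) by (cases "t = 1") auto
qed

end

text \<open>The definition ties \<open>p\<close> only to its derivative within
  \<open>[0, 1]\<close>, so the witness for \<open>p\<close> also serves \<open>q\<close>, whatever
  \<open>F\<close> is and however the two differ outside.\<close>

lemma has_second_derivative_cong:
  assumes "\<And>t. t \<in> {0..1} \<Longrightarrow> p t = q t" "has_second_derivative p d F"
  shows "has_second_derivative q d F"
proof -
  have "(q has_real_derivative D) (at t within {0..1})"
    if "(p has_real_derivative D) (at t within {0..1})" "t \<in> {0..1}" for D t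
    by (rule has_field_derivative_transform_within[OF that(1) zero_less_one that(2)]) (rule assms(1))
  then show ?thesis using assms(2) unfolding has_second_derivative_def by blast
qed



text \<open>At a jump of \<open>u\<close> the curvature is stated separately from each side. At 0
  and 1 it reduces to the payoff term, so a vanishing one-sided limit is excepted there; continuity
  of \<open>u\<close> at 0 rules this out by itself, as the limit is then \<open>u 0 < 0\<close>,
  and likewise at 1.\<close>

theorem proposition2:
  fixes u :: "real \<Rightarrow> real"
  assumes "piecewise_continuous u"
    and "\<forall>t\<in>{0..1}. u t = - u (1 - t)"
    and "\<forall>t\<in>{0..<1/2}. u t < 0"
  shows "(\<exists>p. optimal_solution u p) \<and>
    (\<forall>p q. optimal_solution u p \<and> optimal_solution u q \<longrightarrow> (\<forall>t\<in>{0..1}. p t = q t)) \<and>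
    (\<forall>p. optimal_solution u p \<longrightarrow>
      interior_solution p \<and>
      (\<forall>t\<in>{0..<1/2}. continuous (at t within {0..1}) u \<longrightarrow>
        (\<exists>d>0. has_second_derivative p d (at t within {0..1}))) \<and>
      (\<forall>t\<in>{0..<1/2}. t \<noteq> 0 \<or> \<not> (u \<longlongrightarrow> 0) (at_right 0) \<longrightarrow>
        (\<exists>d>0. has_second_derivative p d (at_right t))) \<and>
      (\<forall>t\<in>{0<..<1/2}. \<exists>d>0. has_second_derivative p d (at_left t)) \<and>
      (\<forall>t\<in>{1/2<..1}. continuous (at t within {0..1}) u \<longrightarrow>
        (\<exists>d<0. has_second_derivative p d (at t within {0..1}))) \<and>
      (\<forall>t\<in>{1/2<..1}. t \<noteq> 1 \<or> \<not> (u \<longlongrightarrow> 0) (at_left 1) \<longrightarrow>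
        (\<exists>d<0. has_second_derivative p d (at_left t))) \<and>
      (\<forall>t\<in>{1/2<..<1}. \<exists>d<0. has_second_derivative p d (at_right t)))"
proof -
  obtain \<theta> v W where st: "stationary u \<theta> v W"
    by (rule stationary_angle[OF assms]) (intro that stationary.intro assms(1))
  interpret stationary u \<theta> v W by (rule st)
  have eq: "q t = p t" if "optimal_solution u q" "t \<in> {0..1}" for q t
    using optimal_unique[OF that] .
  have D2: "has_second_derivative q d F" if "optimal_solution u q" "has_second_derivative p d F" for q d F
    by (rule has_second_derivative_cong[OF _ that(2)]) (simp add: eq[OF that(1)])
  have neg: "u t < 0" if "t \<in> {0..<1/2}" for t using assms(3) that by blast
  have pos: "0 < u t" if "t \<in> {1/2<..1}" for t
    using assms(2)[rule_format, of t] neg[of "1 - t"] that by auto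
  \<comment> \<open>The strict sign of \<open>u\<close> is lost in the limit; away from the end
    points of \<open>[0, 1]\<close> the \<open>v^2\<close> term restores strictness.\<close>
  have R_right: "R \<le> 0" if t: "t \<in> {0..<1/2}" and R: "(u \<longlongrightarrow> R) (at_right t)" for t R
    using R
  proof (rule tendsto_upperbound)
    show "\<forall>\<^sub>F s in at_right t. u s \<le> 0"
      by (rule eventually_at_rightI[of _ "1/2"]) (use t neg in \<open>auto simp: less_imp_le\<close>)
  qed simp
  have R_left: "R \<le> 0" if t: "t \<in> {0<..<1/2}" and R: "(u \<longlongrightarrow> R) (at_left t)" for t R
    using R
  proof (rule tendsto_upperbound)
    show "\<forall>\<^sub>F s in at_left t. u s \<le> 0"
      by (rule eventually_at_leftI[of 0]) (use t neg in \<open>auto simp: less_imp_le\<close>)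
  qed simp
  have L_left: "0 \<le> R" if t: "t \<in> {1/2<..1}" and R: "(u \<longlongrightarrow> R) (at_left t)" for t R
    using R
  proof (rule tendsto_lowerbound)
    show "\<forall>\<^sub>F s in at_left t. 0 \<le> u s"
      by (rule eventually_at_leftI[of "1/2"]) (use t pos in \<open>auto simp: less_imp_le\<close>)
  qed simp
  have L_right: "0 \<le> R" if t: "t \<in> {1/2<..<1}" and R: "(u \<longlongrightarrow> R) (at_right t)" for t R
    using R
  proof (rule tendsto_lowerbound)
    show "\<forall>\<^sub>F s in at_right t. 0 \<le> u s"
      by (rule eventually_at_rightI[of _ 1]) (use t pos in \<open>auto simp: less_imp_le\<close>)
  qed simp
  note limits = piecewise_continuous_limits(1,2)[OF assms(1)]
  show ?thesis
  proof (intro conjI allI impI ballI)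
    show "\<exists>p. optimal_solution u p" using p_optimal by blast
    show "q t = r t" if "optimal_solution u q \<and> optimal_solution u r" "t \<in> {0..1}" for q r t
      using eq[of q t] eq[of r t] that by auto
    fix q assume q: "optimal_solution u q"
    show "interior_solution q"
      using eq[OF q] p_interior by (simp add: interior_solution_def)
    show "\<exists>d>0. has_second_derivative q d (at t within {0..1})"
      if t: "t \<in> {0..<1/2}" and u: "continuous (at t within {0..1}) u" for t
    proof -
      have t': "t \<in> {0..1}" "u t \<le> 0" "t \<noteq> 0 \<or> u t \<noteq> 0" using t neg[OF t] by auto
      from curvature_pos[OF t t'(2,3)] D2[OF q second_derivative_continuous[OF t'(1) u]]
      show ?thesis by blast
    qed
    show "\<exists>d>0. has_second_derivative q d (at_right t)"
      if t: "t \<in> {0..<1/2}" and u: "t \<noteq> 0 \<or> \<not> (u \<longlongrightarrow> 0) (at_right 0)" for t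
    proof -
      have t': "t \<in> {0..<1}" using t by simp
      then obtain R where R: "(u \<longlongrightarrow> R) (at_right t)" using limits(1) by blast
      then have "t \<noteq> 0 \<or> R \<noteq> 0" using u by auto
      from curvature_pos[OF t R_right[OF t R] this] D2[OF q second_derivative_right[OF t' R]]
      show ?thesis by blast
    qed
    show "\<exists>d>0. has_second_derivative q d (at_left t)" if t: "t \<in> {0<..<1/2}" for t
    proof -
      have t': "t \<in> {0<..1}" "t \<in> {0..<1/2}" "t \<noteq> 0 \<or> R \<noteq> 0" for R :: real using t by auto
      then obtain R where R: "(u \<longlongrightarrow> R) (at_left t)" using limits(2) by blast
      from curvature_pos[OF t'(2) R_left[OF t R] t'(3)] D2[OF q second_derivative_left[OF t'(1) R]]
      show ?thesis by blast
    qed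
    show "\<exists>d<0. has_second_derivative q d (at t within {0..1})"
      if t: "t \<in> {1/2<..1}" and u: "continuous (at t within {0..1}) u" for t
    proof -
      have t': "t \<in> {0..1}" "0 \<le> u t" "t \<noteq> 1 \<or> u t \<noteq> 0" using t pos[OF t] by auto
      from curvature_neg[OF t t'(2,3)] D2[OF q second_derivative_continuous[OF t'(1) u]]
      show ?thesis by blast
    qed
    show "\<exists>d<0. has_second_derivative q d (at_left t)"
      if t: "t \<in> {1/2<..1}" and u: "t \<noteq> 1 \<or> \<not> (u \<longlongrightarrow> 0) (at_left 1)" for t
    proof -
      have t': "t \<in> {0<..1}" using t by auto
      then obtain R where R: "(u \<longlongrightarrow> R) (at_left t)" using limits(2) by blast
      then have "t \<noteq> 1 \<or> R \<noteq> 0" using u by auto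
      from curvature_neg[OF t L_left[OF t R] this] D2[OF q second_derivative_left[OF t' R]]
      show ?thesis by blast
    qed
    show "\<exists>d<0. has_second_derivative q d (at_right t)" if t: "t \<in> {1/2<..<1}" for t
    proof -
      have t': "t \<in> {0..<1}" "t \<in> {1/2<..1}" "t \<noteq> 1 \<or> R \<noteq> 0" for R :: real using t by auto
      then obtain R where R: "(u \<longlongrightarrow> R) (at_right t)" using limits(1) by blast
      from curvature_neg[OF t'(2) L_right[OF t R] t'(3)] D2[OF q second_derivative_right[OF t'(1) R]]
      show ?thesis by blast
    qed
  qed
qed

end
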